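(* Assume the following three statements: (1) every countably compact, perfectly normal space is compact; (2) in every compact Hausdorff sequential space, every locally countable subspace of cardinality $\aleph_1$ is $\sigma$-discrete; (3) every normal first countable space is collectionwise Hausdorff. Then every locally compact, perfectly normal space is paracompact.
   Context: A space is collectionwise Hausdorff if every closed discrete subset $D$ can be separated by a pairwise disjoint family of open sets $\{U_d : d\in D\}$ with $d\in U_d$. A subspace is $\sigma$-discrete if it is a countable union of discrete subspaces. A space is locally countable if every point has a countable open neighbourhood (in the subspace). *)

theory Defs
  imports "HOL-Analysis.Analysis"
begin

definition countably_compact_space :: "'a topology \<Rightarrow> bool" where
  "countably_compact_space X \<longleftrightarrow>
     (\<forall>\<U>. countable \<U> \<and> (\<forall>U\<in>\<U>. openin X U) \<and> topspace X \<subseteq> \<Union>\<U> \<longrightarrow>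
        (\<exists>\<F>. finite \<F> \<and> \<F> \<subseteq> \<U> \<and> topspace X \<subseteq> \<Union>\<F>))"

text \<open>
  As with \<^const>\<open>normal_space\<close>, no separation axiom is built in; theorems about these
  notions assume \<^const>\<open>Hausdorff_space\<close> explicitly.
\<close>

definition perfectly_normal_space :: "'a topology \<Rightarrow> bool" where
  "perfectly_normal_space X \<longleftrightarrow>
     normal_space X \<and> (\<forall>C. closedin X C \<longrightarrow> gdelta_in X C)"

definition paracompact_space :: "'a topology \<Rightarrow> bool" where
  "paracompact_space X \<longleftrightarrow>
     (\<forall>\<U>. (\<forall>U\<in>\<U>. openin X U) \<and> topspace X \<subseteq> \<Union>\<U> \<longrightarrow>
        (\<exists>\<V>. (\<forall>V\<in>\<V>. openin X V) \<and> topspace X \<subseteq> \<Union>\<V> \<and>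
             (\<forall>V\<in>\<V>. \<exists>U\<in>\<U>. V \<subseteq> U) \<and> locally_finite_in X \<V>))"

definition sequentially_closedin :: "'a topology \<Rightarrow> 'a set \<Rightarrow> bool" where
  "sequentially_closedin X A \<longleftrightarrow>
     A \<subseteq> topspace X \<and>
     (\<forall>s l. (\<forall>n::nat. s n \<in> A) \<and> limitin X s l sequentially \<longrightarrow> l \<in> A)"

definition sequential_space :: "'a topology \<Rightarrow> bool" where
  "sequential_space X \<longleftrightarrow> (\<forall>A. sequentially_closedin X A \<longrightarrow> closedin X A)"

definition discrete_subspace :: "'a topology \<Rightarrow> 'a set \<Rightarrow> bool" where
  "discrete_subspace X D \<longleftrightarrow>
     D \<subseteq> topspace X \<and> subtopology X D = discrete_topology D"

definition sigma_discrete_subspace :: "'a topology \<Rightarrow> 'a set \<Rightarrow> bool" where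
  "sigma_discrete_subspace X Y \<longleftrightarrow>
     (\<exists>D :: nat \<Rightarrow> 'a set. (\<forall>n. discrete_subspace X (D n)) \<and> Y = (\<Union>n. D n))"

definition locally_countable_subspace :: "'a topology \<Rightarrow> 'a set \<Rightarrow> bool" where
  "locally_countable_subspace X Y \<longleftrightarrow>
     Y \<subseteq> topspace X \<and>
     (\<forall>y\<in>Y. \<exists>U. openin (subtopology X Y) U \<and> y \<in> U \<and> countable U)"

text \<open>\<^const>\<open>natLeq\<close> is the cardinal of the naturals, so its cardinal successor is aleph-one.\<close>

definition has_card_aleph1 :: "'a set \<Rightarrow> bool" where
  "has_card_aleph1 Y \<longleftrightarrow> (card_of Y, cardSuc natLeq) \<in> ordIso"

definition collectionwise_Hausdorff_space :: "'a topology \<Rightarrow> bool" where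
  "collectionwise_Hausdorff_space X \<longleftrightarrow>
     (\<forall>D. closedin X D \<and> discrete_subspace X D \<longrightarrow>
        (\<exists>U :: 'a \<Rightarrow> 'a set. (\<forall>d\<in>D. openin X (U d) \<and> d \<in> U d) \<and> disjoint_family_on U D))"

end

theory Submission
  imports Defs "HOL-Library.Countable_Set_Type"
begin

unbundle cardinal_syntax

text \<open>
  Compact perfectly normal sets are hereditarily Lindelof, so \<open>X\<close> has a cover by open hereditarily
  Lindelof sets, and it suffices to show by induction on the cardinality of a family \<open>\<V>\<close> of such
  sets that \<open>\<Union>\<V>\<close> is a disjoint union of such sets; these are then clopen when \<open>\<Union>\<V> = X\<close>.

  If \<open>\<kappa> = |\<V>|\<close> is singular, decompose the unions of the initial segments of \<open>\<V>\<close> given by a short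
  cofinal set. Each of the resulting pieces meets fewer than \<open>\<kappa>\<close> others, with a uniform bound, so
  the connected components of the intersection graph have size less than \<open>\<kappa>\<close>.

  If \<open>\<kappa>\<close> is regular and uncountable, choose a limit point \<open>y\<^sub>\<gamma>\<close> witnessing that the union of
  an initial segment \<open>\<gamma>\<close> of \<open>\<V>\<close> is not closed. After thinning out, the points \<open>y\<^sub>\<gamma>\<close> are
  right separated and hence locally countable, and they split into fewer than \<open>\<kappa>\<close> discrete sets: by
  a colouring argument if \<open>\<kappa> > \<aleph>\<^sub>1\<close>, and by hypothesis (2) in the one-point compactification if
  \<open>\<kappa> = \<aleph>\<^sub>1\<close>; hypothesis (1) makes the latter sequential. Perfectness turns these into closed
  discrete sets, which (3) separates by disjoint open sets. By the countable chain condition each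
  member of \<open>\<V>\<close> meets fewer than \<open>\<kappa>\<close> of these open sets, so every initial segment closed under a suitable
  function on \<open>\<V>\<close> has closed union, and these segments cut \<open>\<V>\<close> into blocks of size less than \<open>\<kappa>\<close>.
\<close>

section \<open>Open hereditarily Lindelof sets\<close>

text \<open>Allowing families that do not cover \<open>V\<close> is what makes the notion
  hereditary: a subspace of \<open>V\<close> covered by \<open>\<U>\<close> lies in
  \<open>V \<inter> \<Union>\<U>\<close>, hence in the countable subfamily.\<close>

definition hereditarily_Lindelof_openin :: "'a topology \<Rightarrow> 'a set \<Rightarrow> bool" where
  "hereditarily_Lindelof_openin X V \<longleftrightarrow>
     openin X V \<and>
     (\<forall>\<U>. (\<forall>U\<in>\<U>. openin X U) \<longrightarrow> (\<exists>\<C>\<subseteq>\<U>. countable \<C> \<and> V \<inter> \<Union>\<U> \<subseteq> \<Union>\<C>))"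

lemma hereditarily_Lindelof_openin_imp_openin:
  "hereditarily_Lindelof_openin X V \<Longrightarrow> openin X V"
  by (simp add: hereditarily_Lindelof_openin_def)

lemma hereditarily_Lindelof_openinE:
  assumes "hereditarily_Lindelof_openin X V" "\<And>U. U \<in> \<U> \<Longrightarrow> openin X U"
  obtains \<C> where "\<C> \<subseteq> \<U>" "countable \<C>" "V \<inter> \<Union>\<U> \<subseteq> \<Union>\<C>"
  using assms unfolding hereditarily_Lindelof_openin_def by metis

lemma hereditarily_Lindelof_openin_subset:
  assumes "hereditarily_Lindelof_openin X V" "openin X W" "W \<subseteq> V"
  shows "hereditarily_Lindelof_openin X W"
  using assms unfolding hereditarily_Lindelof_openin_def
  by (meson Int_mono order_refl order_trans)

lemma hereditarily_Lindelof_openin_Union: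
  assumes "countable \<V>" "\<And>V. V \<in> \<V> \<Longrightarrow> hereditarily_Lindelof_openin X V"
  shows "hereditarily_Lindelof_openin X (\<Union>\<V>)"
  unfolding hereditarily_Lindelof_openin_def
proof (intro conjI allI impI)
  show "openin X (\<Union>\<V>)"
    using assms(2) hereditarily_Lindelof_openin_imp_openin by blast
  fix \<U> assume \<U>: "\<forall>U\<in>\<U>. openin X U"
  have "\<forall>V\<in>\<V>. \<exists>\<C>\<subseteq>\<U>. countable \<C> \<and> V \<inter> \<Union>\<U> \<subseteq> \<Union>\<C>"
    using assms(2) \<U> by (simp add: hereditarily_Lindelof_openin_def)
  then obtain c where c: "\<And>V. V \<in> \<V> \<Longrightarrow> c V \<subseteq> \<U> \<and> countable (c V) \<and> V \<inter> \<Union>\<U> \<subseteq> \<Union>(c V)"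
    by metis
  show "\<exists>\<C>\<subseteq>\<U>. countable \<C> \<and> \<Union>\<V> \<inter> \<Union>\<U> \<subseteq> \<Union>\<C>"
  proof (intro exI conjI)
    show "\<Union>(c ` \<V>) \<subseteq> \<U>" "countable (\<Union>(c ` \<V>))"
      using c assms(1) by auto
    show "\<Union>\<V> \<inter> \<Union>\<U> \<subseteq> \<Union>(\<Union>(c ` \<V>))"
    proof
      fix x assume "x \<in> \<Union>\<V> \<inter> \<Union>\<U>"
      then obtain V where V: "V \<in> \<V>" "x \<in> V \<inter> \<Union>\<U>" by blast
      then have "x \<in> \<Union>(c V)" using c[OF V(1)] by blast
      then show "x \<in> \<Union>(\<Union>(c ` \<V>))" using V(1) by blast
    qed
  qed
qed

section \<open>Countable chain condition and right separated families\<close>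

text \<open>Take a countable subfamily covering the trace on \<open>V\<close> of all members that
  meet \<open>V\<close>. By disjointness, a point of \<open>V\<close> in \<open>U d\<close> is
  covered by \<open>U d\<close> alone, so no index can be omitted.\<close>

lemma countable_disjoint_family_meeting:
  assumes "hereditarily_Lindelof_openin X V" "disjoint_family_on U D"
    and "\<And>d. d \<in> D \<Longrightarrow> openin X (U d)"
  shows "countable {d \<in> D. U d \<inter> V \<noteq> {}}"
proof -
  let ?D = "{d \<in> D. U d \<inter> V \<noteq> {}}"
  obtain \<C> where "\<C> \<subseteq> U ` ?D" and c: "countable \<C>" and V: "V \<inter> \<Union>(U ` ?D) \<subseteq> \<Union>\<C>"
    using hereditarily_Lindelof_openinE[OF assms(1), of "U ` ?D"] assms(3)
    by (metis (no_types, lifting) imageE mem_Collect_eq)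
  then obtain C where C: "C \<subseteq> ?D" "countable C" "\<C> = U ` C"
    by (metis (no_types, lifting) countable_subset_image)
  have "?D \<subseteq> C"
  proof
    fix d assume d: "d \<in> ?D"
    then obtain x where "x \<in> U d" "x \<in> V" by blast
    then obtain e where "e \<in> C" "x \<in> U e" using V C d by blast
    then have "d = e"
      using C d \<open>x \<in> U d\<close> disjoint_family_onD[OF assms(2), of d e] by blast
    then show "d \<in> C" using \<open>e \<in> C\<close> by simp
  qed
  then show ?thesis using C(2) countable_subset by blast
qed

text \<open>Let \<open>A0\<close> be the indices with countably many predecessors in
  \<open>A\<close>. Countably many \<open>N c\<close> with \<open>c\<close> in \<open>A0\<close>
  cover the points indexed by \<open>A0\<close>, and separation puts every index covered by
  \<open>N c\<close> at or below \<open>c\<close>; so \<open>A0\<close> is a countable union of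
  countable sets.\<close>

lemma countable_right_separated:
  assumes V: "hereditarily_Lindelof_openin X V"
    and r: "Well_order r" "T \<subseteq> Field r"
    and N: "\<And>a. a \<in> T \<Longrightarrow> openin X (N a) \<and> f a \<in> N a"
    and sep: "\<And>a b. \<lbrakk>a \<in> T; b \<in> T; (a, b) \<in> r; a \<noteq> b\<rbrakk> \<Longrightarrow> f b \<notin> N a"
  shows "countable {a \<in> T. f a \<in> V}"
proof -
  define A where "A = {a \<in> T. f a \<in> V}"
  define A0 where "A0 = {a \<in> A. countable (A \<inter> underS r a)}"
  have tot: "(a, b) \<in> r \<or> (b, a) \<in> r" if "a \<in> T" "b \<in> T" for a b
    using r that wo_rel.TOTALS[of r] unfolding wo_rel_def by blast
  obtain \<C> where "\<C> \<subseteq> N ` A0" "countable \<C>" and \<C>: "V \<inter> \<Union>(N ` A0) \<subseteq> \<Union>\<C>"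
  proof (rule hereditarily_Lindelof_openinE[OF V, of "N ` A0"])
    show "openin X U" if "U \<in> N ` A0" for U using that N by (auto simp: A0_def A_def)
  qed
  then obtain C where C: "C \<subseteq> A0" "countable C" "\<C> = N ` C"
    by (metis countable_subset_image)
  have "A0 \<subseteq> (\<Union>c\<in>C. insert c (A \<inter> underS r c))"
  proof
    fix a assume a: "a \<in> A0"
    then have "f a \<in> V \<inter> \<Union>(N ` A0)" using N by (auto simp: A0_def A_def)
    then obtain c where c: "c \<in> C" "f a \<in> N c" using \<C> C(3) by blast
    have "(a, c) \<in> r \<or> a = c"
      using c C(1) a sep[of c a] tot[of a c] by (auto simp: A0_def A_def)
    then have "a \<in> insert c (A \<inter> underS r c)"
      using a by (auto simp: A0_def underS_def)
    then show "a \<in> (\<Union>c\<in>C. insert c (A \<inter> underS r c))" using c by blast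
  qed
  moreover have "countable (\<Union>c\<in>C. insert c (A \<inter> underS r c))"
    using C by (intro countable_UN) (auto simp: A0_def)
  ultimately have A0: "countable A0" by (rule countable_subset)
  \<comment> \<open>A least index outside \<open>A0\<close> would have all its predecessors in the
    countable set \<open>A0\<close>, and so belong to \<open>A0\<close>.\<close>
  have "A \<subseteq> A0"
  proof (rule ccontr)
    assume "\<not> A \<subseteq> A0"
    moreover have "wf (r - Id)" using r(1) by (simp add: well_order_on_def)
    ultimately obtain a where a: "a \<in> A - A0" and min: "\<And>b. (b, a) \<in> r - Id \<Longrightarrow> b \<notin> A - A0"
      by (metis Diff_eq_empty_iff all_not_in_conv wfE_min)
    have "A \<inter> underS r a \<subseteq> A0" using min by (auto simp: underS_def)
    then have "a \<in> A0" using a A0 countable_subset by (auto simp: A0_def)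
    then show False using a by simp
  qed
  then show ?thesis using A0 countable_subset unfolding A_def by blast
qed

section \<open>Discrete subspaces\<close>

lemma discrete_subspace_iff:
  "discrete_subspace X D \<longleftrightarrow> D \<subseteq> topspace X \<and> (\<forall>d\<in>D. \<exists>U. openin X U \<and> U \<inter> D = {d})"
proof (cases "D \<subseteq> topspace X")
  case True
  have "discrete_topology D = subtopology X D \<longleftrightarrow> (\<forall>d\<in>D. openin (subtopology X D) {d})"
    using True by (auto simp: discrete_topology_unique)
  then show ?thesis
    using True unfolding discrete_subspace_def openin_subtopology by (metis (no_types, lifting))
qed (simp add: discrete_subspace_def)

lemma discrete_subspace_subset:
  assumes "discrete_subspace X D" "E \<subseteq> D"
  shows "discrete_subspace X E"
  unfolding discrete_subspace_iff
proof (intro conjI ballI)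
  show "E \<subseteq> topspace X" using assms by (auto simp: discrete_subspace_iff)
  fix e assume e: "e \<in> E"
  then obtain U where "openin X U" "U \<inter> D = {e}"
    using assms unfolding discrete_subspace_iff by blast
  then show "\<exists>U. openin X U \<and> U \<inter> E = {e}" using e assms(2) by blast
qed

lemma perfectly_normal_openin_fsigma_in:
  "perfectly_normal_space X \<Longrightarrow> openin X U \<Longrightarrow> fsigma_in X U"
  by (simp add: perfectly_normal_space_def fsigma_in_gdelta_in openin_subset openin_closedin_eq)

text \<open>In the open set of all points with a neighbourhood meeting \<open>D\<close> at most once, \<open>D\<close> is closed;
  this open set is an \<open>F\<^sub>\<sigma>\<close>.\<close>

lemma discrete_subspace_sigma_closed_discrete:
  assumes X: "perfectly_normal_space X" "Hausdorff_space X" and D: "discrete_subspace X D"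
  obtains E :: "nat \<Rightarrow> 'a set"
  where "\<And>n. closedin X (E n)" "\<And>n. discrete_subspace X (E n)" "D = (\<Union>n. E n)"
proof -
  define W where "W = \<Union>{U. openin X U \<and> (\<exists>d. U \<inter> D \<subseteq> {d})}"
  have "openin X W" unfolding W_def by blast
  then have "fsigma_in X W" by (rule perfectly_normal_openin_fsigma_in[OF X(1)])
  then obtain F :: "nat \<Rightarrow> 'a set" where F: "\<And>n. closedin X (F n)" "(\<Union>n. F n) = W"
    by (auto simp: fsigma_in_ascending)
  have DW: "D \<subseteq> W"
  proof
    fix d assume "d \<in> D"
    then obtain U where "openin X U" "U \<inter> D = {d}" using D unfolding discrete_subspace_iff by blast
    then show "d \<in> W" unfolding W_def by (intro UnionI[of U]) auto
  qed
  have Dtop: "D \<subseteq> topspace X" using D by (simp add: discrete_subspace_def)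
  have cl: "x \<in> D" if x: "x \<in> X closure_of D" "x \<in> W" for x
  proof -
    obtain U d where U: "openin X U" "U \<inter> D \<subseteq> {d}" "x \<in> U"
      using x(2) unfolding W_def by blast
    \<comment> \<open>\<open>U\<close> meets \<open>D\<close>, and only in \<open>d\<close>. If
      \<open>x\<close> differed from \<open>d\<close>, deleting the closed point \<open>d\<close>
      from \<open>U\<close> would leave a neighbourhood of \<open>x\<close> missing
      \<open>D\<close>. The witness \<open>d\<close> is not known in advance to lie in the space,
      hence the second disjunct.\<close>
    show ?thesis
    proof (cases "x = d \<or> d \<notin> topspace X")
      case True
      have "\<exists>y. y \<in> D \<and> y \<in> U" using x(1) U unfolding in_closure_of by blast
      then show ?thesis using True U(2) Dtop by blast
    next
      case False
      then have "openin X (U - {d})"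
        using U X(2) by (simp add: openin_diff closedin_Hausdorff_singleton)
      moreover have "x \<in> U - {d}" using U False by simp
      ultimately have "\<exists>y. y \<in> D \<and> y \<in> U - {d}"
        using x(1)[unfolded in_closure_of, THEN conjunct2, rule_format, of "U - {d}"] by simp
      then show ?thesis using U(2) by blast
    qed
  qed
  show thesis
  proof
    fix n
    have "D \<inter> F n = X closure_of D \<inter> F n"
      using cl F(2) closure_of_subset[OF Dtop] by blast
    then show "closedin X (D \<inter> F n)" using F(1) by auto
    show "discrete_subspace X (D \<inter> F n)" using D by (rule discrete_subspace_subset) simp
    show "D = (\<Union>n. D \<inter> F n)" using F(2) DW by blast
  qed
qed

section \<open>Local structure of locally compact perfectly normal spaces\<close>

text \<open>Any open set is a countable union of closed sets, so its trace on a compact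
  neighbourhood \<open>K\<close> is \<sigma>-compact, and countably many finite subfamilies cover
  it.\<close>

lemma hereditarily_Lindelof_openin_locally:
  assumes "perfectly_normal_space X" "locally_compact_space X" "x \<in> topspace X"
  obtains V where "hereditarily_Lindelof_openin X V" "x \<in> V"
proof -
  obtain V K where V: "openin X V" "compactin X K" "x \<in> V" "V \<subseteq> K"
    using assms(2,3) unfolding locally_compact_space_def by blast
  have "\<exists>\<C>\<subseteq>\<U>. countable \<C> \<and> V \<inter> \<Union>\<U> \<subseteq> \<Union>\<C>" if \<U>: "\<forall>U\<in>\<U>. openin X U" for \<U>
  proof -
    have "openin X (\<Union>\<U>)" using \<U> by blast
    then have "fsigma_in X (\<Union>\<U>)" by (rule perfectly_normal_openin_fsigma_in[OF assms(1)])
    then obtain F :: "nat \<Rightarrow> 'a set" where F: "\<And>n. closedin X (F n)" "(\<Union>n. F n) = \<Union>\<U>"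
      by (auto simp: fsigma_in_ascending)
    have "\<exists>\<C>. finite \<C> \<and> \<C> \<subseteq> \<U> \<and> K \<inter> F n \<subseteq> \<Union>\<C>" for n
    proof -
      have "compactin X (K \<inter> F n)" using F(1) V(2) compact_Int_closedin by blast
      moreover have "K \<inter> F n \<subseteq> \<Union>\<U>" using F(2) by blast
      ultimately show ?thesis using \<U> unfolding compactin_def by blast
    qed
    then obtain c where c: "\<And>n. finite (c n) \<and> c n \<subseteq> \<U> \<and> K \<inter> F n \<subseteq> \<Union>(c n)"
      by metis
    show ?thesis
    proof (intro exI conjI)
      show "(\<Union>n. c n) \<subseteq> \<U>" "countable (\<Union>n. c n)"
        using c by (auto intro: countable_finite)
      show "V \<inter> \<Union>\<U> \<subseteq> \<Union>(\<Union>n. c n)"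
      proof
        fix y assume "y \<in> V \<inter> \<Union>\<U>"
        then obtain n where "y \<in> K \<inter> F n" using V(4) F(2) by blast
        then have "y \<in> \<Union>(c n)" using c[of n] by blast
        then show "y \<in> \<Union>(\<Union>n. c n)" by blast
      qed
    qed
  qed
  then show thesis using that V unfolding hereditarily_Lindelof_openin_def by blast
qed

lemma first_countable_closure_sequence:
  assumes "first_countable X" "x \<in> X closure_of A"
  obtains s where "\<And>n::nat. s n \<in> A" "limitin X s x sequentially"
proof -
  have x: "x \<in> topspace X" using assms(2) by (simp add: in_closure_of)
  obtain \<B> where \<B>: "countable \<B>" "\<And>V. V \<in> \<B> \<Longrightarrow> openin X V"
     "\<And>U. openin X U \<Longrightarrow> x \<in> U \<Longrightarrow> \<exists>V\<in>\<B>. x \<in> V \<and> V \<subseteq> U"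
    using assms(1) x unfolding first_countable_def by meson
  define \<B>' where "\<B>' = {V \<in> \<B>. x \<in> V}"
  have ne: "\<B>' \<noteq> {}" using \<B>(3)[OF openin_topspace x] by (auto simp: \<B>'_def)
  moreover have "countable \<B>'" using \<B>(1) by (simp add: \<B>'_def)
  ultimately have e: "range (from_nat_into \<B>') = \<B>'" by (rule range_from_nat_into)
  define G where "G n = (\<Inter>i\<le>n. from_nat_into \<B>' i)" for n
  have G: "openin X (G n) \<and> x \<in> G n" for n
  proof -
    have "from_nat_into \<B>' i \<in> \<B>'" for i using ne by (rule from_nat_into)
    then have "openin X (from_nat_into \<B>' i) \<and> x \<in> from_nat_into \<B>' i" for i
      using \<B>(2) by (auto simp: \<B>'_def)
    then show ?thesis unfolding G_def by (auto intro!: openin_INT2)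
  qed
  have "\<forall>n. \<exists>y. y \<in> A \<and> y \<in> G n"
    using assms(2) G unfolding in_closure_of by blast
  then obtain s where s: "\<And>n. s n \<in> A \<and> s n \<in> G n" by metis
  have "limitin X s x sequentially"
    unfolding limitin_sequentially
  proof (intro conjI x allI impI)
    fix U assume "openin X U \<and> x \<in> U"
    then obtain V where "V \<in> \<B>'" "V \<subseteq> U" using \<B>(3) by (auto simp: \<B>'_def)
    then obtain i where i: "from_nat_into \<B>' i \<subseteq> U" using e by (metis imageE)
    have "s n \<in> U" if "n \<ge> i" for n
      using s[of n] that i unfolding G_def by blast
    then show "\<exists>N. \<forall>n\<ge>N. s n \<in> U" by blast
  qed
  then show thesis using s that by blast
qed

text \<open>Points are G-delta sets. Shrinking the open sets by regularity to closed neighbourhoods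
  inside a compact set turns such a representation into a countable base at the point.\<close>

lemma locally_compact_perfectly_normal_first_countable:
  assumes H: "Hausdorff_space X" and lc: "locally_compact_space X" and pn: "perfectly_normal_space X"
  shows "first_countable X"
  unfolding first_countable_def
proof
  fix x assume x: "x \<in> topspace X"
  have reg: "regular_space X" using H lc by (simp add: locally_compact_Hausdorff_imp_regular_space)
  obtain V K where V: "openin X V" "compactin X K" "x \<in> V" "V \<subseteq> K"
    using lc x unfolding locally_compact_space_def by blast
  have "gdelta_in X {x}"
    using pn H x unfolding perfectly_normal_space_def by (simp add: closedin_Hausdorff_singleton)
  then obtain G where G: "\<And>n::nat. openin X (G n)" "\<And>n. G (Suc n) \<subseteq> G n" "(\<Inter>n. G n) = {x}"
    by (auto simp: gdelta_in_descending)
  have "\<exists>O' C. openin X O' \<and> closedin X C \<and> x \<in> O' \<and> O' \<subseteq> C \<and> C \<subseteq> V \<inter> G n" for n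
  proof -
    have "openin X (V \<inter> G n)" "x \<in> V \<inter> G n" using V G(1) G(3)[THEN equalityD2] by auto
    then show ?thesis
      using reg unfolding neighbourhood_base_of_closedin[symmetric] neighbourhood_base_of by blast
  qed
  then obtain B C where B: "\<And>n. openin X (B n) \<and> closedin X (C n) \<and> x \<in> B n \<and> B n \<subseteq> C n \<and> C n \<subseteq> V \<inter> G n"
    by metis
  define \<B> where "\<B> = range (\<lambda>n. \<Inter>i\<le>n. B i)"
  show "\<exists>\<B>. countable \<B> \<and> (\<forall>V\<in>\<B>. openin X V) \<and>
             (\<forall>U. openin X U \<and> x \<in> U \<longrightarrow> (\<exists>V\<in>\<B>. x \<in> V \<and> V \<subseteq> U))"
  proof (intro exI conjI allI impI ballI)
    show "countable \<B>" by (simp add: \<B>_def)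
    show "openin X W" if "W \<in> \<B>" for W
      using that B by (auto simp: \<B>_def intro!: openin_INT2)
    fix U assume U: "openin X U \<and> x \<in> U"
    \<comment> \<open>The sets \<open>C n\<close> intersect in \<open>{x}\<close>, so their
      complements cover the compact set \<open>K - U\<close>; finitely many suffice, and the
      corresponding finite intersection lies in \<open>U\<close>.\<close>
    have "compactin X (K - U)"
      using V(2) U by (metis Diff_eq Int_Diff closedin_diff closedin_topspace compact_Int_closedin
          compactin_subset_topspace inf.absorb1)
    moreover have "K - U \<subseteq> \<Union>(range (\<lambda>n. topspace X - C n))"
    proof
      fix y assume y: "y \<in> K - U"
      then have "y \<noteq> x" using U by blast
      then obtain n where "y \<notin> G n" using G(3) by blast
      then show "y \<in> \<Union>(range (\<lambda>n. topspace X - C n))"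
        using B[of n] y compactin_subset_topspace[OF V(2)] by blast
    qed
    moreover have "\<forall>W\<in>range (\<lambda>n. topspace X - C n). openin X W" using B by auto
    ultimately obtain \<F> where "finite \<F>" "\<F> \<subseteq> range (\<lambda>n. topspace X - C n)" "K - U \<subseteq> \<Union>\<F>"
      unfolding compactin_def by meson
    then obtain N where N: "finite N" "K - U \<subseteq> (\<Union>n\<in>N. topspace X - C n)"
      by (metis (no_types, lifting) finite_subset_image)
    obtain m where m: "\<And>n. n \<in> N \<Longrightarrow> n \<le> m"
      using N(1) by (meson finite_nat_set_iff_bounded_le)
    have "(\<Inter>i\<le>m. B i) \<subseteq> U"
    proof
      fix y assume y: "y \<in> (\<Inter>i\<le>m. B i)"
      then have "y \<in> B 0" by simp
      then have "y \<in> K" using B[of 0] V(4) by blast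
      moreover have "y \<in> C n" if "n \<in> N" for n using y m[OF that] B[of n] by blast
      ultimately show "y \<in> U" using N(2) by blast
    qed
    then show "\<exists>V\<in>\<B>. x \<in> V \<and> V \<subseteq> U" using B by (auto simp: \<B>_def)
  qed
qed

section \<open>Paracompactness from a disjoint decomposition\<close>

text \<open>Disjointness of the open pieces reduces local finiteness to a single piece, where a
  countable cover is refined by removing earlier closed sets, as for regular Lindelof
  spaces.\<close>

lemma paracompact_space_disjoint_union:
  assumes reg: "regular_space X" and disj: "disjoint \<P>" and top: "\<Union>\<P> = topspace X"
    and hL: "\<And>P. P \<in> \<P> \<Longrightarrow> hereditarily_Lindelof_openin X P"
  shows "paracompact_space X"
  unfolding paracompact_space_def
proof (intro allI impI)
  fix \<U> assume \<U>: "(\<forall>U\<in>\<U>. openin X U) \<and> topspace X \<subseteq> \<Union>\<U>"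
  have "\<exists>Ob Cl U. openin X Ob \<and> closedin X Cl \<and> U \<in> \<U> \<and> x \<in> Ob \<and> Ob \<subseteq> Cl \<and> Cl \<subseteq> U"
    if x: "x \<in> topspace X" for x
  proof -
    obtain U where "U \<in> \<U>" "x \<in> U" using \<U> x by blast
    then show ?thesis
      using reg \<U> unfolding neighbourhood_base_of_closedin[symmetric] neighbourhood_base_of by meson
  qed
  then obtain Ob Cl R where R: "\<And>x. x \<in> topspace X \<Longrightarrow> openin X (Ob x) \<and> closedin X (Cl x) \<and> R x \<in> \<U>
      \<and> x \<in> Ob x \<and> Ob x \<subseteq> Cl x \<and> Cl x \<subseteq> R x"
    by metis
  have Ptop: "P \<subseteq> topspace X" if "P \<in> \<P>" for P using top that by blast
  have "\<exists>q::nat \<Rightarrow> 'a. P \<subseteq> (\<Union>n. Ob (q n)) \<and> range q \<subseteq> topspace X" if P0: "P \<in> \<P>" "P \<noteq> {}" for P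
  proof -
    obtain \<C> where \<C>: "\<C> \<subseteq> Ob ` P" "countable \<C>" "P \<inter> \<Union>(Ob ` P) \<subseteq> \<Union>\<C>"
    proof (rule hereditarily_Lindelof_openinE[OF hL[OF P0(1)], of "Ob ` P"])
      show "openin X U" if "U \<in> Ob ` P" for U
        using that R Ptop[OF \<open>P \<in> \<P>\<close>] by blast
    qed blast
    then obtain Q where Q: "Q \<subseteq> P" "countable Q" "\<C> = Ob ` Q"
      by (metis countable_subset_image)
    have P: "P \<subseteq> \<Union>(Ob ` Q)"
      using \<C>(3) Q(3) R Ptop[OF that(1)] by blast
    then have "Q \<noteq> {}" using that(2) by auto
    then have "range (from_nat_into Q) = Q" using Q(2) by (rule range_from_nat_into)
    then show ?thesis using P Q(1) Ptop[OF that(1)]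
      by (metis image_image subset_trans)
  qed
  then obtain q :: "'a set \<Rightarrow> nat \<Rightarrow> 'a" where
    q: "\<And>P. P \<in> \<P> \<Longrightarrow> P \<noteq> {} \<Longrightarrow> P \<subseteq> (\<Union>n. Ob (q P n)) \<and> range (q P) \<subseteq> topspace X"
    by metis
  \<comment> \<open>The enumerations \<open>q P\<close> are available only for nonempty
    pieces.\<close>
  define \<P>' where "\<P>' = \<P> - {{}}"
  have qR: "openin X (Ob (q P n)) \<and> closedin X (Cl (q P n)) \<and> R (q P n) \<in> \<U>
      \<and> Ob (q P n) \<subseteq> Cl (q P n) \<and> Cl (q P n) \<subseteq> R (q P n)" if "P \<in> \<P>'" for P n
  proof -
    have "q P n \<in> topspace X" using q[of P] that by (auto simp: \<P>'_def)
    then show ?thesis using R by blast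
  qed
  \<comment> \<open>Three nested sets are used: the large \<open>R\<close> keeps \<open>S\<close> a
    cover, removing the closed \<open>Cl\<close> keeps it open, and the small open
    \<open>Ob (q P k)\<close> misses \<open>S P n\<close> for all \<open>n > k\<close>.\<close>
  define S where "S P n = P \<inter> R (q P n) - (\<Union>k<n. Cl (q P k))" for P n
  show "\<exists>\<V>. (\<forall>V\<in>\<V>. openin X V) \<and> topspace X \<subseteq> \<Union>\<V> \<and>
             (\<forall>V\<in>\<V>. \<exists>U\<in>\<U>. V \<subseteq> U) \<and> locally_finite_in X \<V>"
  proof (intro exI conjI)
    let ?\<V> = "\<Union>P\<in>\<P>'. range (S P)"
    have op: "openin X (S P n)" if "P \<in> \<P>'" for P n
    proof -
      have "openin X P" using that hL hereditarily_Lindelof_openin_imp_openin by (auto simp: \<P>'_def)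
      moreover have "openin X (R (q P n))" using qR[OF that] \<U> by blast
      moreover have "closedin X (\<Union>k<n. Cl (q P k))" using qR[OF that] by (intro closedin_Union) auto
      ultimately show ?thesis unfolding S_def by blast
    qed
    then show "\<forall>V\<in>?\<V>. openin X V" by blast
    show "\<forall>V\<in>?\<V>. \<exists>U\<in>\<U>. V \<subseteq> U"
      using qR unfolding S_def by blast
    show "topspace X \<subseteq> \<Union>?\<V>"
    proof
      fix x assume "x \<in> topspace X"
      then obtain P where P: "P \<in> \<P>'" "x \<in> P" using top by (auto simp: \<P>'_def)
      then obtain m where "x \<in> Ob (q P m)" using q[of P] by (auto simp: \<P>'_def)
      then have m: "x \<in> R (q P m)" using qR[OF P(1), of m] by blast
      \<comment> \<open>Minimality is taken with respect to \<open>R\<close>; since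
        \<open>Cl\<close> lies inside \<open>R\<close>, no earlier \<open>Cl\<close> contains
        \<open>x\<close>.\<close>
      define n where "n = (LEAST n. x \<in> R (q P n))"
      have "x \<in> R (q P n)" unfolding n_def using m by (rule LeastI)
      moreover have "x \<notin> Cl (q P k)" if "k < n" for k
        using not_less_Least[of k "\<lambda>n. x \<in> R (q P n)"] that qR[OF P(1), of k] by (auto simp: n_def)
      ultimately have "x \<in> S P n" using P by (auto simp: S_def)
      then show "x \<in> \<Union>?\<V>" using P by blast
    qed
    show "locally_finite_in X ?\<V>"
      unfolding locally_finite_in_def
    proof (intro conjI ballI)
      show "\<Union>?\<V> \<subseteq> topspace X" using op openin_subset by blast
      fix x assume "x \<in> topspace X"
      then obtain P where P: "P \<in> \<P>'" "x \<in> P" using top by (auto simp: \<P>'_def)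
      then obtain k where k: "x \<in> Ob (q P k)" using q[of P] by (auto simp: \<P>'_def)
      have "openin X (P \<inter> Ob (q P k))"
        using P(1) qR[OF P(1), of k] hL[THEN hereditarily_Lindelof_openin_imp_openin]
        unfolding \<P>'_def by (intro openin_Int) blast+
      moreover have "{V \<in> ?\<V>. V \<inter> (P \<inter> Ob (q P k)) \<noteq> {}} \<subseteq> S P ` {..k}"
      proof
        fix V assume "V \<in> {V \<in> ?\<V>. V \<inter> (P \<inter> Ob (q P k)) \<noteq> {}}"
        then obtain P' n where V: "P' \<in> \<P>'" "V = S P' n" "S P' n \<inter> (P \<inter> Ob (q P k)) \<noteq> {}" by blast
        then have "P' \<inter> P \<noteq> {}" unfolding S_def by blast
        then have "P' = P" using disj V(1) P(1) unfolding \<P>'_def disjoint_def by blast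
        moreover have "n \<le> k"
        proof (rule ccontr)
          assume "\<not> n \<le> k"
          then have "S P n \<inter> Cl (q P k) = {}" unfolding S_def by auto
          then show False using V(3) qR[OF P(1), of k] unfolding \<open>P' = P\<close> by blast
        qed
        ultimately show "V \<in> S P ` {..k}" using V by blast
      qed
      then have "finite {V \<in> ?\<V>. V \<inter> (P \<inter> Ob (q P k)) \<noteq> {}}"
        using finite_surj by blast
      ultimately show "\<exists>V. openin X V \<and> x \<in> V \<and> finite {U \<in> ?\<V>. U \<inter> V \<noteq> {}}"
        using P k by blast
    qed
  qed
qed

section \<open>The one-point compactification\<close>

lemma locally_countable_subspace_iff:
  "locally_countable_subspace X Y \<longleftrightarrow>
     Y \<subseteq> topspace X \<and> (\<forall>y\<in>Y. \<exists>U. openin X U \<and> y \<in> U \<and> countable (U \<inter> Y))"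
  unfolding locally_countable_subspace_def openin_subtopology by blast

lemma homeomorphic_map_sequential_space:
  assumes h: "homeomorphic_map X X' h" and X: "sequential_space X"
  shows "sequential_space X'"
  unfolding sequential_space_def
proof (intro allI impI)
  fix A assume A: "sequentially_closedin X' A"
  define B where "B = {x \<in> topspace X. h x \<in> A}"
  have hX: "h ` topspace X = topspace X'" using h by (simp add: homeomorphic_imp_surjective_map)
  have hB: "h ` B = A" 
  proof
    show "A \<subseteq> h ` B"
    proof
      fix y assume y: "y \<in> A"
      then have "y \<in> h ` topspace X" using A hX unfolding sequentially_closedin_def by blast
      then show "y \<in> h ` B" using y by (auto simp: B_def)
    qed
  qed (auto simp: B_def)
  have "sequentially_closedin X B"
    unfolding sequentially_closedin_def
  proof (intro conjI allI impI)
    show "B \<subseteq> topspace X" by (auto simp: B_def)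
    fix s l assume sl: "(\<forall>n::nat. s n \<in> B) \<and> limitin X s l sequentially"
    then have "limitin X' (h \<circ> s) (h l) sequentially"
      using h by (meson continuous_map_limit homeomorphic_imp_continuous_map)
    moreover have "\<forall>n. (h \<circ> s) n \<in> A" using sl by (auto simp: B_def)
    ultimately have "h l \<in> A" using A unfolding sequentially_closedin_def by blast
    then show "l \<in> B" using sl limitin_topspace by (fastforce simp: B_def)
  qed
  then have "closedin X B" using X by (simp add: sequential_space_def)
  then show "closedin X' A" using h hB by (metis homeomorphic_imp_closed_map closed_map_def)
qed

text \<open>If \<open>A\<close> is closed in \<open>X\<close> and not countably compact, choose a countable cover
  without finite subcover and points of \<open>A\<close> escaping from its finite subfamilies: they leave every
  compact set, so they converge to the point at infinity.\<close>

lemma sequential_space_Alexandroff_compactification: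
  assumes X: "first_countable X"
    and cc: "\<And>A. closedin X A \<Longrightarrow> countably_compact_space (subtopology X A) \<Longrightarrow> compactin X A"
  shows "sequential_space (Alexandroff_compactification X)"
  unfolding sequential_space_def
proof (intro allI impI)
  let ?Z = "Alexandroff_compactification X"
  fix S assume S: "sequentially_closedin ?Z S"
  define A where "A = {x \<in> topspace X. Some x \<in> S}"
  have Stop: "S \<subseteq> insert None (Some ` topspace X)"
    using S by (simp add: sequentially_closedin_def)
  have lim: "l \<in> S" if "\<And>n::nat. s n \<in> S" "limitin ?Z s l sequentially" for s l
    using S that unfolding sequentially_closedin_def by blast
  \<comment> \<open>First countability yields sequences in \<open>A\<close> converging to closure
    points; their images under \<open>Some\<close> converge in the compactification, where
    \<open>S\<close> is sequentially closed.\<close>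
  have "X closure_of A \<subseteq> A"
  proof
    fix x assume x: "x \<in> X closure_of A"
    then obtain s where s: "\<And>n::nat. s n \<in> A" "limitin X s x sequentially"
      using first_countable_closure_sequence[OF X] by metis
    have "limitin ?Z (Some \<circ> s) (Some x) sequentially"
      using s(2) continuous_map_Some by (rule continuous_map_limit[rotated])
    then have "Some x \<in> S" by (rule lim[rotated]) (use s(1) in \<open>auto simp: A_def\<close>)
    then show "x \<in> A" using x by (simp add: A_def in_closure_of)
  qed
  moreover have Atop: "A \<subseteq> topspace X" by (auto simp: A_def)
  ultimately have A: "closedin X A" by (metis closure_of_subset_eq)
  show "closedin ?Z S"
  proof (cases "None \<in> S")
    case True
    have "S = topspace ?Z - Some ` (topspace X - A)"
      using True Stop by (auto simp: A_def)
    moreover have "openin X (topspace X - A)" using A by blast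
    ultimately show ?thesis unfolding closedin_Alexandroff_compactification by blast
  next
    case False
    have "countably_compact_space (subtopology X A)"
    proof (rule ccontr)
      assume "\<not> countably_compact_space (subtopology X A)"
      then obtain \<U> where \<U>: "countable \<U>" "\<And>U. U \<in> \<U> \<Longrightarrow> openin (subtopology X A) U" "A \<subseteq> \<Union>\<U>"
        and nofin: "\<And>\<F>. finite \<F> \<Longrightarrow> \<F> \<subseteq> \<U> \<Longrightarrow> \<not> A \<subseteq> \<Union>\<F>"
        unfolding countably_compact_space_def using Atop by (auto simp: Int_absorb1)
      have "\<U> \<noteq> {}" using nofin[of "{}"] \<U>(3) by auto
      then have U: "range (from_nat_into \<U>) = \<U>" using \<U>(1) by (rule range_from_nat_into)
      let ?U = "from_nat_into \<U>"
      have "\<exists>a. a \<in> A \<and> (\<forall>k\<le>n. a \<notin> ?U k)" for n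
      proof -
        have "?U ` {..n} \<subseteq> \<U>" using U by blast
        then have "\<not> A \<subseteq> \<Union>(?U ` {..n})" by (intro nofin) auto
        then show ?thesis by auto
      qed
      then obtain a where a: "\<And>n::nat. a n \<in> A \<and> (\<forall>k\<le>n. a n \<notin> ?U k)" by metis
      have "limitin ?Z (Some \<circ> a) None sequentially"
        unfolding limitin_sequentially
      proof (intro conjI allI impI)
        show "None \<in> topspace ?Z" by simp
        fix W assume W: "openin ?Z W \<and> None \<in> W"
        then obtain C where C: "compactin X C" "closedin X C" "W = insert None (Some ` (topspace X - C))"
          unfolding openin_Alexandroff_compactification by auto
        have "compactin (subtopology X A) (A \<inter> C)"
          using A C(1) by (simp add: compactin_subtopology closed_Int_compactin)
        moreover have "A \<inter> C \<subseteq> \<Union>\<U>" using \<U>(3) by blast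
        ultimately obtain \<F> where \<F>: "finite \<F>" "\<F> \<subseteq> range ?U" "A \<inter> C \<subseteq> \<Union>\<F>"
          unfolding U compactin_def using \<U>(2) by meson
        then obtain N where N: "finite N" "\<F> = ?U ` N"
          by (metis finite_subset_image)
        obtain m where m: "\<And>n. n \<in> N \<Longrightarrow> n \<le> m"
          using N(1) by (meson finite_nat_set_iff_bounded_le)
        have "(Some \<circ> a) n \<in> W" if n: "n \<ge> m" for n
        proof -
          have "a n \<notin> ?U k" if "k \<in> N" for k
            using a[of n] m[OF that] n by simp
          then have "a n \<notin> C" using \<F>(3) N(2) a[of n] by blast
          then show ?thesis using C(3) a[of n] Atop by auto
        qed
        then show "\<exists>N. \<forall>n\<ge>N. (Some \<circ> a) n \<in> W" by blast
      qed
      then have "None \<in> S" by (rule lim[rotated]) (use a in \<open>auto simp: A_def\<close>)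
      then show False using False by simp
    qed
    then have "compactin X A" using A cc by blast
    moreover have "S = Some ` A" using False Stop by (auto simp: A_def)
    ultimately show ?thesis using A by simp
  qed
qed

lemma perfectly_normal_space_closed_subtopology:
  assumes X: "perfectly_normal_space X" and A: "closedin X A"
  shows "perfectly_normal_space (subtopology X A)"
  unfolding perfectly_normal_space_def
proof (intro conjI allI impI)
  show "normal_space (subtopology X A)"
    using X A by (simp add: perfectly_normal_space_def normal_space_closed_subtopology)
  fix C assume "closedin (subtopology X A) C"
  then have C: "closedin X C" "C \<subseteq> A" using A by (auto simp: closedin_closed_subtopology)
  then have "gdelta_in X C" using X by (simp add: perfectly_normal_space_def)
  then obtain G where G: "\<And>n::nat. openin X (G n)" "\<And>n. G (Suc n) \<subseteq> G n" "(\<Inter>n. G n) = C"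
    by (auto simp: gdelta_in_descending)
  show "gdelta_in (subtopology X A) C"
    unfolding gdelta_in_descending
  proof (intro exI conjI allI)
    show "openin (subtopology X A) (A \<inter> G n)" for n
      using G(1) by (rule openin_subtopology_Int2)
    show "A \<inter> G (Suc n) \<subseteq> A \<inter> G n" for n using G(2) by blast
    show "(\<Inter>n. A \<inter> G n) = C" using G(3) C(2) by blast
  qed
qed

section \<open>Returning the compactification to the original type\<close>

text \<open>Hypothesis (2) speaks of topologies on \<open>'a\<close>, while the compactification
  lives on \<open>'a option\<close>. An infinite type has room for the extra point:
  \<open>None\<close> goes to \<open>undefined\<close>, and \<open>k\<close> maps everything else
  off it.\<close>

lemma embed_option:
  assumes "infinite (UNIV :: 'a set)"
  obtains h :: "'a option \<Rightarrow> 'a" where "inj h"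
proof -
  obtain k :: "'a \<Rightarrow> 'a" where k: "bij_betw k UNIV (UNIV - {undefined})"
    using infinite_imp_bij_betw[OF assms] by blast
  have "inj (case_option undefined k)"
  proof (rule injI)
    fix x y assume "case_option undefined k x = case_option undefined k y"
    moreover have "k z \<noteq> undefined" for z using k bij_betwE by fastforce
    ultimately show "x = y"
      using bij_betw_imp_inj_on[OF k] by (auto split: option.splits dest: injD) metis+
  qed
  then show thesis by (rule that)
qed

text \<open>The copy is the pullback of \<open>X\<close> along \<open>inv h\<close>, whose open sets
  are the images under \<open>h\<close> of the open sets of \<open>X\<close>.\<close>

lemma homeomorphic_map_inj_copy:
  assumes "inj h"
  obtains X' where "homeomorphic_map X X' h"
proof -
  have op: "openin (pullback_topology (range h) (inv h) X) S \<longleftrightarrow> (\<exists>U. openin X U \<and> S = h ` U)" for S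
    unfolding openin_pullback_topology using assms by (auto simp: image_iff inv_f_f) (auto 4 4 simp: inv_f_f)
  have top: "topspace (pullback_topology (range h) (inv h) X) = h ` topspace X"
    unfolding topspace_pullback_topology using assms by (auto simp: inv_f_f)
  have "homeomorphic_map X (pullback_topology (range h) (inv h) X) h"
  proof (rule bijective_open_imp_homeomorphic_map)
    show "continuous_map X (pullback_topology (range h) (inv h) X) h"
      unfolding continuous_map_def
    proof (intro conjI allI impI)
      show "h \<in> topspace X \<rightarrow> topspace (pullback_topology (range h) (inv h) X)" using top by auto
      fix S assume "openin (pullback_topology (range h) (inv h) X) S"
      then obtain U where U: "openin X U" "S = h ` U" using op by blast
      then have "{x \<in> topspace X. h x \<in> S} = U"
        using openin_subset[OF U(1)] injD[OF assms] by auto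
      then show "openin X {x \<in> topspace X. h x \<in> S}" using U(1) by simp
    qed
    show "open_map X (pullback_topology (range h) (inv h) X) h"
      unfolding open_map_def using op by blast
    show "inj_on h (topspace X)" using assms inj_on_subset by blast
  qed (simp add: top)
  then show thesis by (rule that)
qed

text \<open>The open embedding \<open>e\<close> of \<open>X\<close> into a copy \<open>Z\<close> of
  its compactification preserves local countability and cardinality of \<open>Y\<close>; the
  discrete sets obtained in \<open>Z\<close> are pulled back along \<open>e\<close>.\<close>

lemma locally_countable_imp_sigma_discrete:
  fixes X :: "'a topology"
  assumes hyp: "\<And>(Z :: 'a topology) Y.
       compact_space Z \<Longrightarrow> Hausdorff_space Z \<Longrightarrow> sequential_space Z \<Longrightarrow>
       locally_countable_subspace Z Y \<Longrightarrow> has_card_aleph1 Y \<Longrightarrow> sigma_discrete_subspace Z Y"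
    and X: "Hausdorff_space X" "locally_compact_space X"
    and seq: "sequential_space (Alexandroff_compactification X)"
    and Y: "locally_countable_subspace X Y" "has_card_aleph1 Y"
  shows "sigma_discrete_subspace X Y"
proof -
  \<comment> \<open>This makes the type \<open>'a\<close> infinite, as the embedding of
    \<open>'a option\<close> requires.\<close>
  have "infinite Y"
  proof -
    have "natLeq \<le>o |Y|"
      using Y(2) cardSuc_greater[OF natLeq_Card_order] unfolding has_card_aleph1_def
      by (meson ordLess_imp_ordLeq ordIso_symmetric ordLeq_ordIso_trans)
    then show ?thesis using infinite_iff_natLeq_ordLeq by blast
  qed
  then have "infinite (UNIV :: 'a set)" by (rule infinite_super[OF subset_UNIV])
  then obtain h :: "'a option \<Rightarrow> 'a" where h: "inj h" by (rule embed_option)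
  obtain Z where Z: "homeomorphic_map (Alexandroff_compactification X) Z h"
    using homeomorphic_map_inj_copy[OF h] by blast
  define e where "e = h \<circ> Some"
  have inj: "inj e" using h by (simp add: e_def inj_compose)
  have cont: "continuous_map X Z e"
    unfolding e_def using continuous_map_Some homeomorphic_imp_continuous_map[OF Z]
    by (rule continuous_map_compose)
  have open_e: "open_map X Z e"
    unfolding e_def using open_map_Some homeomorphic_imp_open_map[OF Z] by (rule open_map_compose)
  have Ytop: "Y \<subseteq> topspace X" using Y(1) by (simp add: locally_countable_subspace_def)
  have hs: "Alexandroff_compactification X homeomorphic_space Z"
    using Z by (rule homeomorphic_map_imp_homeomorphic_space)
  have "sigma_discrete_subspace Z (e ` Y)"
  proof (rule hyp)
    show "compact_space Z" using homeomorphic_compact_space[OF hs] by simp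
    show "Hausdorff_space Z"
      using homeomorphic_Hausdorff_space[OF hs] X by (simp add: Hausdorff_space_Alexandroff_compactification)
    show "sequential_space Z" using Z seq by (rule homeomorphic_map_sequential_space)
    show "locally_countable_subspace Z (e ` Y)"
      unfolding locally_countable_subspace_iff
    proof (intro conjI ballI)
      show "e ` Y \<subseteq> topspace Z" using cont Ytop continuous_map_image_subset_topspace by blast
      fix z assume "z \<in> e ` Y"
      then obtain y where y: "y \<in> Y" "z = e y" by blast
      then obtain U where U: "openin X U" "y \<in> U" "countable (U \<inter> Y)"
        using Y(1) unfolding locally_countable_subspace_iff by blast
      have "e ` U \<inter> e ` Y = e ` (U \<inter> Y)" using inj by (simp add: image_Int)
      then show "\<exists>U. openin Z U \<and> z \<in> U \<and> countable (U \<inter> e ` Y)"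
        using U y open_e unfolding open_map_def by (metis countable_image imageI)
    qed
    have "|e ` Y| =o |Y|"
      using inj by (meson card_of_ordIsoI inj_on_imp_bij_betw inj_on_subset ordIso_symmetric subset_UNIV)
    then show "has_card_aleph1 (e ` Y)"
      using Y(2) unfolding has_card_aleph1_def by (rule ordIso_transitive)
  qed
  then obtain D :: "nat \<Rightarrow> 'a set" where D: "\<And>n. discrete_subspace Z (D n)" "e ` Y = (\<Union>n. D n)"
    unfolding sigma_discrete_subspace_def by blast
  have "discrete_subspace X {y \<in> Y. e y \<in> D n}" for n
    unfolding discrete_subspace_iff
  proof (intro conjI ballI)
    show "{y \<in> Y. e y \<in> D n} \<subseteq> topspace X" using Ytop by blast
    fix y assume y: "y \<in> {y \<in> Y. e y \<in> D n}"
    then obtain U where U: "openin Z U" "U \<inter> D n = {e y}"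
      using D(1) unfolding discrete_subspace_iff by blast
    have "openin X {x \<in> topspace X. e x \<in> U}" using cont U(1) by (rule openin_continuous_map_preimage)
    moreover have "{x \<in> topspace X. e x \<in> U} \<inter> {y \<in> Y. e y \<in> D n} = {y}"
    proof
      show "{x \<in> topspace X. e x \<in> U} \<inter> {y \<in> Y. e y \<in> D n} \<subseteq> {y}"
      proof
        fix x assume "x \<in> {x \<in> topspace X. e x \<in> U} \<inter> {y \<in> Y. e y \<in> D n}"
        then have "e x \<in> U \<inter> D n" by blast
        then have "e x = e y" using U(2) by simp
        then show "x \<in> {y}" using injD[OF inj] by simp
      qed
      have "e y \<in> U" using U(2) by blast
      then show "{y} \<subseteq> {x \<in> topspace X. e x \<in> U} \<inter> {y \<in> Y. e y \<in> D n}"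
        using y Ytop by blast
    qed
    ultimately show "\<exists>U. openin X U \<and> U \<inter> {y \<in> Y. e y \<in> D n} = {y}" by blast
  qed
  moreover have "Y = (\<Union>n. {y \<in> Y. e y \<in> D n})"
  proof -
    have "e y \<in> (\<Union>n. D n)" if "y \<in> Y" for y using that D(2) by blast
    then show ?thesis by blast
  qed
  ultimately show ?thesis
    unfolding sigma_discrete_subspace_def by (intro exI[of _ "\<lambda>n. {y \<in> Y. e y \<in> D n}"]) simp
qed

section \<open>Decomposition into open hereditarily Lindelof sets\<close>

definition Lindelof_decomposable :: "'a topology \<Rightarrow> 'a set \<Rightarrow> bool" where
  "Lindelof_decomposable X G \<longleftrightarrow>
     (\<exists>\<P>. disjoint \<P> \<and> \<Union>\<P> = G \<and> (\<forall>P\<in>\<P>. hereditarily_Lindelof_openin X P))"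

text \<open>The label \<open>\<phi>\<close> is constant along intersections, so the unions belonging
  to different labels are disjoint and their decompositions can be joined. The labels will be graph
  components in the singular case and closures of segments in the regular case.\<close>

lemma Lindelof_decomposable_glue:
  assumes meet: "\<And>i j. \<lbrakk>i \<in> I; j \<in> I; W i \<inter> W j \<noteq> {}\<rbrakk> \<Longrightarrow> \<phi> i = \<phi> j"
    and dec: "\<And>i. i \<in> I \<Longrightarrow> Lindelof_decomposable X (\<Union>(W ` {j \<in> I. \<phi> j = \<phi> i}))"
  shows "Lindelof_decomposable X (\<Union>(W ` I))"
proof -
  define H where "H c = \<Union>(W ` {j \<in> I. \<phi> j = c})" for c
  have "\<forall>c\<in>\<phi> ` I. \<exists>\<P>. disjoint \<P> \<and> \<Union>\<P> = H c \<and> (\<forall>P\<in>\<P>. hereditarily_Lindelof_openin X P)"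
    using dec unfolding Lindelof_decomposable_def H_def by blast
  then obtain p where p: "\<And>c. c \<in> \<phi> ` I \<Longrightarrow>
      disjoint (p c) \<and> \<Union>(p c) = H c \<and> (\<forall>P\<in>p c. hereditarily_Lindelof_openin X P)"
    by metis
  have H: "H c \<inter> H d = {}" if "c \<noteq> d" for c d
    using meet that unfolding H_def by blast
  show ?thesis
    unfolding Lindelof_decomposable_def
  proof (intro exI conjI)
    show "disjoint (\<Union>(p ` \<phi> ` I))"
      unfolding disjoint_def
    proof (intro ballI impI)
      fix P Q assume P: "P \<in> \<Union>(p ` \<phi> ` I)" and Q: "Q \<in> \<Union>(p ` \<phi> ` I)" and ne: "P \<noteq> Q"
      obtain c where c: "c \<in> \<phi> ` I" "P \<in> p c" using P by blast
      obtain d where d: "d \<in> \<phi> ` I" "Q \<in> p d" using Q by blast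
      show "P \<inter> Q = {}"
      proof (cases "c = d")
        case True
        then show ?thesis using p[OF c(1)] c(2) d(2) ne by (auto simp: disjoint_def)
      next
        case False
        then show ?thesis using H[OF False] p[OF c(1)] p[OF d(1)] c(2) d(2) by blast
      qed
    qed
    have "\<Union>(\<Union>(p ` \<phi> ` I)) = (\<Union>c\<in>\<phi> ` I. \<Union>(p c))" by blast
    also have "\<dots> = (\<Union>c\<in>\<phi> ` I. H c)" using p by (intro SUP_cong) auto
    also have "\<dots> = \<Union>(W ` I)" unfolding H_def by blast
    finally show "\<Union>(\<Union>(p ` \<phi> ` I)) = \<Union>(W ` I)" .
    show "\<forall>P\<in>\<Union>(p ` \<phi> ` I). hereditarily_Lindelof_openin X P" using p by blast
  qed
qed

section \<open>Cardinal bounds\<close>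

lemma uncountable_nat_ordLess: "uncountable A \<Longrightarrow> |UNIV :: nat set| <o |A|"
  unfolding countable_card_of_nat
  using not_ordLeq_iff_ordLess[OF card_of_Well_order card_of_Well_order] by blast

lemma Plus_nat_ordLess:
  assumes "uncountable A" "|K| <o |A|"
  shows "|K <+> (UNIV :: nat set)| <o |A|"
  using assms by (intro card_of_Plus_ordLess_infinite uncountable_nat_ordLess)
    (auto dest: countable_finite)

text \<open>The sum with the naturals represents |K| + \<aleph>0: a bound that is infinite even for
  finite \<open>K\<close>, as bounding unions requires, and still below an uncountable cardinal
  exceeding |K|.\<close>

lemma Plus_nat_facts:
  fixes K :: "'k set"
  shows "infinite (K <+> (UNIV :: nat set))"
    and "|K| \<le>o |K <+> (UNIV :: nat set)|"
    and "countable C \<Longrightarrow> |C| \<le>o |K <+> (UNIV :: nat set)|"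
proof -
  show "infinite (K <+> (UNIV :: nat set))" by (simp add: finite_Plus_iff)
  show "|K| \<le>o |K <+> (UNIV :: nat set)|" by (rule card_of_Plus1)
  show "|C| \<le>o |K <+> (UNIV :: nat set)|" if "countable C"
    using that[unfolded countable_card_of_nat] card_of_Plus2 by (rule ordLeq_transitive)
qed

lemma underS_card_of_subset: "underS |A| b \<subseteq> A"
  using FieldI1[of _ b "|A|"] by (auto simp: underS_def Field_card_of)

lemma UNION_countable_ordLess:
  assumes "uncountable A" "|K| <o |A|" "\<And>k. k \<in> K \<Longrightarrow> countable (F k)"
  shows "|\<Union>k\<in>K. F k| <o |A|"
proof -
  have "|\<Union>k\<in>K. F k| \<le>o |K <+> (UNIV :: nat set)|"
    using assms(3) by (intro card_of_UNION_ordLeq_infinite ballI Plus_nat_facts)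
  then show ?thesis using Plus_nat_ordLess[OF assms(1,2)] by (rule ordLeq_ordLess_trans)
qed

section \<open>The singular case\<close>

lemma Lindelof_decomposable_singular:
  fixes \<V> :: "'a set set"
  assumes \<V>: "\<And>V. V \<in> \<V> \<Longrightarrow> hereditarily_Lindelof_openin X V" "uncountable \<V>"
    and K: "K \<subseteq> \<V>" "cofinal K |\<V>|" "|K| <o |\<V>|"
    and IH: "\<And>\<W> :: 'a set set. \<lbrakk>|\<W>| <o |\<V>|; \<And>V. V \<in> \<W> \<Longrightarrow> hereditarily_Lindelof_openin X V\<rbrakk>
               \<Longrightarrow> Lindelof_decomposable X (\<Union>\<W>)"
  shows "Lindelof_decomposable X (\<Union>\<V>)"
proof -
  let ?r = "|\<V>|"
  let ?B = "K <+> (UNIV :: nat set)"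
  have "Lindelof_decomposable X (\<Union>(underS ?r b))" if "b \<in> K" for b
  proof (rule IH)
    show "|underS ?r b| <o ?r" using K(1) that by (intro card_of_underS card_of_Card_order) (auto simp: Field_card_of)
    show "hereditarily_Lindelof_openin X V" if "V \<in> underS ?r b" for V
      using \<V>(1)[OF subsetD[OF underS_card_of_subset that]] .
  qed
  then have "\<forall>b\<in>K. \<exists>\<P>. disjoint \<P> \<and> \<Union>\<P> = \<Union>(underS ?r b)
      \<and> (\<forall>P\<in>\<P>. hereditarily_Lindelof_openin X P)"
    by (simp add: Lindelof_decomposable_def)
  then obtain p where "\<forall>b\<in>K. disjoint (p b) \<and> \<Union>(p b) = \<Union>(underS ?r b)
      \<and> (\<forall>P\<in>p b. hereditarily_Lindelof_openin X P)"
    by (rule bchoice[THEN exE])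
  note p = this[THEN bspec]
  define \<Q> where "\<Q> = (\<Union>b\<in>K. p b) - {{}}"
  have hL: "hereditarily_Lindelof_openin X Q" if "Q \<in> \<Q>" for Q using that p by (auto simp: \<Q>_def)
  have "\<Union>\<Q> = (\<Union>b\<in>K. \<Union>(p b))" by (auto simp: \<Q>_def)
  also have "\<dots> = (\<Union>b\<in>K. \<Union>(underS ?r b))" using p by (intro SUP_cong) auto
  also have "\<dots> = \<Union>\<V>"
  proof
    show "(\<Union>b\<in>K. \<Union>(underS ?r b)) \<subseteq> \<Union>\<V>" 
      by (intro UN_least Union_mono underS_card_of_subset)
    show "\<Union>\<V> \<subseteq> (\<Union>b\<in>K. \<Union>(underS ?r b))"
    proof
      fix x assume "x \<in> \<Union>\<V>"
      then obtain V where V: "V \<in> \<V>" "x \<in> V" by blast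
      then obtain b where "b \<in> K" "V \<in> underS ?r b"
        using K(2) by (auto simp: cofinal_def underS_def Field_card_of)
      then show "x \<in> (\<Union>b\<in>K. \<Union>(underS ?r b))" using V(2) by (intro UN_I[of b] UnionI)
    qed
  qed
  finally have un: "\<Union>\<Q> = \<Union>\<V>" .
  \<comment> \<open>\<open>E\<close> is the intersection graph. For each \<open>b\<close> in
    \<open>K\<close> the pieces in \<open>p b\<close> are disjoint, so a given piece meets only
    countably many of them.\<close>
  define E where "E = {(P, Q). P \<in> \<Q> \<and> Q \<in> \<Q> \<and> P \<inter> Q \<noteq> {}}"
  have E: "|E `` {P}| \<le>o |?B|" for P
  proof (cases "P \<in> \<Q>")
    case True
    have "E `` {P} \<subseteq> (\<Union>b\<in>K. {Q \<in> p b. Q \<inter> P \<noteq> {}})"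
      by (auto simp: E_def \<Q>_def)
    moreover have "|\<Union>b\<in>K. {Q \<in> p b. Q \<inter> P \<noteq> {}}| \<le>o |?B|"
    proof (intro card_of_UNION_ordLeq_infinite ballI Plus_nat_facts)
      fix b assume b: "b \<in> K"
      have "disjoint_family_on (\<lambda>Q. Q) (p b)"
        using p[OF b] by (auto simp: disjoint_family_on_def disjoint_def)
      then show "countable {Q \<in> p b. Q \<inter> P \<noteq> {}}"
        using p[OF b]
        by (intro countable_disjoint_family_meeting[OF hL[OF True]])
          (auto intro: hereditarily_Lindelof_openin_imp_openin)
    qed
    ultimately show ?thesis by (rule ordLeq_transitive[OF card_of_mono1])
  next
    case False
    then have "E `` {P} = {}" by (auto simp: E_def)
    then show ?thesis by (simp add: card_of_empty)
  qed
  \<comment> \<open>One bound \<open>?B\<close> serves all balls of the graph. Bounds merely below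
    |\<V>| would not survive the countable union forming a component if |\<V>| had countable
    cofinality.\<close>
  have En: "|(E ^^ n) `` {P}| \<le>o |?B|" for n P
  proof (induction n)
    case 0
    show ?case using Plus_nat_facts(3)[of "{P}" K] by simp
  next
    case (Suc n)
    have "(E ^^ Suc n) `` {P} = (\<Union>Q\<in>(E ^^ n) `` {P}. E `` {Q})" by auto
    then show ?case
      using card_of_UNION_ordLeq_infinite[OF Plus_nat_facts(1) Suc, of "\<lambda>Q. E `` {Q}"] E by simp
  qed
  define C where "C P = E\<^sup>* `` {P}" for P
  have C: "|C P| <o |\<V>|" for P
  proof -
    have "C P = (\<Union>n. (E ^^ n) `` {P})" by (auto simp: C_def rtrancl_power)
    moreover have "|\<Union>n. (E ^^ n) `` {P}| \<le>o |?B|"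
      by (intro card_of_UNION_ordLeq_infinite ballI Plus_nat_facts(1) card_of_Plus2 En)
    ultimately show ?thesis using ordLeq_ordLess_trans[OF _ Plus_nat_ordLess[OF \<V>(2) K(3)]] by simp
  qed
  have "Lindelof_decomposable X (\<Union>((\<lambda>Q. Q) ` \<Q>))"
  proof (rule Lindelof_decomposable_glue)
    fix P Q assume "P \<in> \<Q>" "Q \<in> \<Q>" "P \<inter> Q \<noteq> {}"
    then have PQ: "(P, Q) \<in> E" "(Q, P) \<in> E" by (auto simp: E_def)
    \<comment> \<open>Intersection is symmetric, so each of \<open>P\<close> and \<open>Q\<close>
      reaches whatever the other reaches.\<close>
    show "C P = C Q"
      unfolding C_def using PQ by (auto intro: converse_rtrancl_into_rtrancl)
  next
    fix P assume "P \<in> \<Q>"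
    have "{Q \<in> \<Q>. C Q = C P} \<subseteq> C P" by (auto simp: C_def)
    then have "|{Q \<in> \<Q>. C Q = C P}| <o |\<V>|"
      using C by (rule ordLeq_ordLess_trans[OF card_of_mono1])
    then show "Lindelof_decomposable X (\<Union>((\<lambda>Q. Q) ` {Q \<in> \<Q>. C Q = C P}))"
      using IH[of "{Q \<in> \<Q>. C Q = C P}"] hL by simp
  qed
  then show ?thesis using un by simp
qed

section \<open>The regular uncountable case\<close>

lemma regularCard_bounded:
  assumes "Card_order r" "regularCard r" "K \<subseteq> Field r" "|K| <o r"
  obtains g where "g \<in> Field r" "\<And>a. a \<in> K \<Longrightarrow> (a, g) \<in> r"
proof -
  have wo: "wo_rel r" using assms(1) by (simp add: wo_rel_def card_order_on_well_order_on)
  have "\<not> cofinal K r"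
    using assms(2,3,4) not_ordLess_ordIso unfolding regularCard_def by blast
  then obtain g where g: "g \<in> Field r" "\<And>b. b \<in> K \<Longrightarrow> g = b \<or> (g, b) \<notin> r"
    unfolding cofinal_def by blast
  have "(a, g) \<in> r" if "a \<in> K" for a
    using g(2)[OF that] wo_rel.TOTALS[OF wo] g(1) assms(3) that by blast
  then show thesis using g(1) that by blast
qed

text \<open>An infinite cardinal has no last element, so the segment up to and including
  \<open>a\<close> lies in a strict initial segment.\<close>

lemma card_of_under_ordLess:
  assumes "Card_order r" "infinite (Field r)" "a \<in> Field r"
  shows "|under r a| <o r"
proof -
  obtain b where b: "b \<in> Field r" "a \<noteq> b" "(a, b) \<in> r"
    using infinite_Card_order_limit[OF assms] by blast
  have wo: "wo_rel r" using assms(1) by (simp add: wo_rel_def card_order_on_well_order_on)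
  have "under r a \<subseteq> underS r b"
    using b wo_rel.TRANS[OF wo] wo_rel.ANTISYM[OF wo]
    unfolding under_def underS_def trans_def antisym_def by blast
  then show ?thesis
    using card_of_underS[OF assms(1) b(1)] card_of_mono1 ordLeq_ordLess_trans by blast
qed

text \<open>If \<open>|I| > \<aleph>\<^sub>1\<close>, then \<open>\<aleph>\<^sub>1\<close> colours suffice: colour recursively, each point avoiding the
  countably many colours of the earlier points in its neighbourhood.\<close>

lemma right_separated_few_discrete:
  fixes y :: "'b \<Rightarrow> 'a" and I :: "'c set"
  assumes sd: "\<And>Y. locally_countable_subspace X Y \<Longrightarrow> has_card_aleph1 Y \<Longrightarrow> sigma_discrete_subspace X Y"
    and r: "Well_order r" "T \<subseteq> Field r"
    and N: "\<And>a. a \<in> T \<Longrightarrow> hereditarily_Lindelof_openin X (N a) \<and> y a \<in> N a"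
    and sep: "\<And>a b. \<lbrakk>a \<in> T; b \<in> T; (a, b) \<in> r; a \<noteq> b\<rbrakk> \<Longrightarrow> y b \<notin> N a"
    and I: "uncountable I" "|T| \<le>o |I|"
  obtains \<D> where "|\<D>| <o |I|" "\<Union>\<D> = y ` T" "\<And>D. D \<in> \<D> \<Longrightarrow> discrete_subspace X D"
proof -
  have tot: "(a, b) \<in> r \<or> (b, a) \<in> r" if "a \<in> T" "b \<in> T" for a b
    using r that wo_rel.TOTALS[of r] unfolding wo_rel_def by blast
  have opN: "openin X (N a) \<and> y a \<in> N a" if "a \<in> T" for a
    using N[OF that] hereditarily_Lindelof_openin_imp_openin by blast
  \<comment> \<open>Each \<open>N a\<close> is itself hereditarily Lindelof, so right separation
    allows it only countably many of the points; this gives local countability.\<close>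
  have cnt: "countable {b \<in> T. y b \<in> N a}" if "a \<in> T" for a
    using N that r opN sep by (intro countable_right_separated[where N = N and r = r]) auto
  have top: "y ` T \<subseteq> topspace X" using opN openin_subset by blast
  have lc: "locally_countable_subspace X (y ` T)"
    unfolding locally_countable_subspace_iff
  proof (intro conjI ballI top)
    fix x assume "x \<in> y ` T"
    then obtain a where a: "a \<in> T" "x = y a" by blast
    have "N a \<inter> y ` T \<subseteq> y ` {b \<in> T. y b \<in> N a}" by blast
    then have "countable (N a \<inter> y ` T)" using cnt[OF a(1)] by (meson countable_image countable_subset)
    then show "\<exists>U. openin X U \<and> x \<in> U \<and> countable (U \<inter> y ` T)" using opN[OF a(1)] a(2) by blast
  qed
  have natI: "natLeq <o |I|"
    using uncountable_nat_ordLess[OF I(1)] card_of_nat ordIso_ordLess_trans ordIso_symmetric by blast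
  have small: "|\<D>| <o |I|" if "countable \<D>" for \<D> :: "'a set set"
    using that uncountable_nat_ordLess[OF I(1)] ordLeq_ordLess_trans by (auto simp: countable_card_of_nat)
  have leI: "cardSuc natLeq \<le>o |I|"
    using natI by (rule cardSuc_least[OF natLeq_Card_order card_of_Card_order])
  show thesis
  proof (cases "|I| =o cardSuc natLeq")
    case True
    \<comment> \<open>Here |I| is \<aleph>1. The hypothesis \<open>sd\<close> concerns sets of size
      exactly \<aleph>1, so a countable \<open>T\<close> is split into singletons
      separately.\<close>
    show thesis
    proof (cases "countable T")
      case T: True
      show thesis
      proof (rule that)
        show "|(\<lambda>a. {y a}) ` T| <o |I|" using T by (intro small) simp
        show "\<Union>((\<lambda>a. {y a}) ` T) = y ` T" by blast
        show "discrete_subspace X D" if "D \<in> (\<lambda>a. {y a}) ` T" for D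
        proof -
          have "D \<subseteq> topspace X" "openin X (topspace X)" using that top by auto
          then show ?thesis using that unfolding discrete_subspace_iff by blast
        qed
      qed
    next
      case False
      have inj: "inj_on y T"
        using tot sep opN by (intro inj_onI) metis
      have "natLeq <o |y ` T|"
      proof -
        have "uncountable (y ` T)" using False inj countable_image_inj_on by blast
        then show ?thesis
          using uncountable_nat_ordLess card_of_nat ordIso_ordLess_trans ordIso_symmetric by blast
      qed
      then have "cardSuc natLeq \<le>o |y ` T|" by (rule cardSuc_least[OF natLeq_Card_order card_of_Card_order])
      moreover have "|y ` T| \<le>o cardSuc natLeq"
        using card_of_image[of y T] I(2) True ordLeq_transitive ordLeq_ordIso_trans by blast
      ultimately have "has_card_aleph1 (y ` T)"
        unfolding has_card_aleph1_def by (simp add: ordIso_iff_ordLeq)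
      then obtain D :: "nat \<Rightarrow> 'a set" where D: "\<And>n. discrete_subspace X (D n)" "y ` T = (\<Union>n. D n)"
        using sd[OF lc] unfolding sigma_discrete_subspace_def by blast
      show thesis
        by (rule that[of "range D"]) (use D in \<open>auto intro!: small\<close>)
    qed
  next
    case False
    \<comment> \<open>The colours are the elements of the field of \<open>cardSuc natLeq\<close>,
      which are sets of naturals; there are \<aleph>1 of them, now fewer than |I|.\<close>
    define Q where "Q = Field (cardSuc natLeq)"
    have Q: "|Q| =o cardSuc natLeq"
      unfolding Q_def by (simp add: card_of_Field_ordIso cardSuc_Card_order natLeq_Card_order)
    have QI: "|Q| <o |I|"
      using False leI Q ordIso_ordLess_trans ordLeq_iff_ordLess_or_ordIso ordIso_symmetric by blast
    have "natLeq <o |Q|"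
      using cardSuc_greater[OF natLeq_Card_order] Q ordIso_symmetric ordLess_ordIso_trans by blast
    then have Qunc: "uncountable Q"
      using countable_card_le_natLeq not_ordLess_ordLeq by blast
    \<comment> \<open>\<open>P f x q\<close> says that \<open>q\<close> is an admissible colour for
      \<open>x\<close> when \<open>f\<close> has coloured the earlier points. Only countably many
      colours are forbidden, so one always remains.\<close>
    define P where "P f x q \<longleftrightarrow> (x \<in> T \<longrightarrow> q \<in> Q \<and> q \<notin> f ` {b \<in> T. (b, x) \<in> r - Id \<and> y b \<in> N x})"
      for f :: "'b \<Rightarrow> nat set" and x q
    have "\<exists>c. \<forall>x. P c x (c x)"
    proof (rule dependent_wf_choice)
      show "wf (r - Id)" using r(1) by (simp add: well_order_on_def)
      show "P f x q = P g x q" if "\<And>z. (z, x) \<in> r - Id \<Longrightarrow> f z = g z" for f g x q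
      proof -
        have "f ` {b \<in> T. (b, x) \<in> r - Id \<and> y b \<in> N x} = g ` {b \<in> T. (b, x) \<in> r - Id \<and> y b \<in> N x}"
          using that by (intro image_cong) auto
        then show ?thesis by (simp add: P_def)
      qed
      show "\<exists>q. P f x q" for f x
      proof (cases "x \<in> T")
        case True
        have "countable {b \<in> T. (b, x) \<in> r - Id \<and> y b \<in> N x}"
          using cnt[OF True] by (rule countable_subset[rotated]) blast
        then have "\<not> Q \<subseteq> f ` {b \<in> T. (b, x) \<in> r - Id \<and> y b \<in> N x}"
          using Qunc by (meson countable_image countable_subset)
        then show ?thesis unfolding P_def by blast
      qed (simp add: P_def)
    qed
    then obtain c where c: "\<And>x. x \<in> T \<Longrightarrow> c x \<in> Q"
      "\<And>x b. \<lbrakk>x \<in> T; b \<in> T; (b, x) \<in> r; b \<noteq> x; y b \<in> N x\<rbrakk> \<Longrightarrow> c x \<noteq> c b"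
      unfolding P_def by blast
    show thesis
    proof (rule that)
      show "|(\<lambda>q. y ` {a \<in> T. c a = q}) ` Q| <o |I|"
        using card_of_image QI ordLeq_ordLess_trans by blast
      show "\<Union>((\<lambda>q. y ` {a \<in> T. c a = q}) ` Q) = y ` T" using c(1) by blast
      fix D assume "D \<in> (\<lambda>q. y ` {a \<in> T. c a = q}) ` Q"
      then obtain q where D: "D = y ` {a \<in> T. c a = q}" by blast
      \<comment> \<open>Within one colour class, \<open>N a\<close> misses later points by
        separation and earlier points by the choice of colours.\<close>
      have "N a \<inter> D = {y a}" if a: "a \<in> T" "c a = q" for a
      proof -
        have "b = a" if "b \<in> T" "c b = q" "y b \<in> N a" for b
          using tot[OF a(1) that(1)] sep[OF a(1) that(1)] c(2)[OF a(1) that(1)] a that by blast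
        then show ?thesis using a opN unfolding D by blast
      qed
      then show "discrete_subspace X D"
        unfolding discrete_subspace_iff
      proof (intro conjI ballI)
        show "D \<subseteq> topspace X" using top unfolding D by blast
        fix d assume "d \<in> D"
        then obtain a where a: "a \<in> T" "c a = q" "d = y a" unfolding D by blast
        then show "\<exists>U. openin X U \<and> U \<inter> D = {d}"
          using opN[OF a(1)] \<open>\<And>a. a \<in> T \<Longrightarrow> c a = q \<Longrightarrow> N a \<inter> D = {y a}\<close>[OF a(1,2)] by blast
      qed
    qed
  qed
qed

text \<open>Perfectness splits each discrete set into countably many closed discrete ones, and the
  uncountable |I| absorbs the factor \<aleph>0.\<close>

lemma few_closed_discrete:
  assumes X: "perfectly_normal_space X" "Hausdorff_space X"
    and I: "uncountable I" and \<D>: "|\<D>| <o |I|" "\<And>D. D \<in> \<D> \<Longrightarrow> discrete_subspace X D"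
  obtains \<E> where "|\<E>| <o |I|" "\<Union>\<E> = \<Union>\<D>"
    "\<And>E. E \<in> \<E> \<Longrightarrow> closedin X E \<and> discrete_subspace X E"
proof -
  have "\<exists>E :: nat \<Rightarrow> 'a set. (\<forall>n. closedin X (E n) \<and> discrete_subspace X (E n)) \<and> D = (\<Union>n. E n)"
    if D: "D \<in> \<D>" for D
  proof -
    obtain E :: "nat \<Rightarrow> 'a set"
      where "\<And>n. closedin X (E n)" "\<And>n. discrete_subspace X (E n)" "D = (\<Union>n. E n)"
      using discrete_subspace_sigma_closed_discrete[OF X \<D>(2)[OF D]] by metis
    then show ?thesis by (intro exI[of _ E]) simp
  qed
  then have "\<forall>D\<in>\<D>. \<exists>E :: nat \<Rightarrow> 'a set. (\<forall>n. closedin X (E n) \<and> discrete_subspace X (E n)) \<and> D = (\<Union>n. E n)"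
    by (rule ballI)
  then obtain e where "\<forall>D\<in>\<D>. (\<forall>n::nat. closedin X (e D n) \<and> discrete_subspace X (e D n)) \<and> D = (\<Union>n. e D n)"
    by (rule bchoice[THEN exE])
  note e = this[THEN bspec]
  show thesis
  proof (rule that)
    show "|\<Union>D\<in>\<D>. range (e D)| <o |I|"
      using I \<D>(1) by (rule UNION_countable_ordLess) simp
    have "\<Union>(\<Union>D\<in>\<D>. range (e D)) = (\<Union>D\<in>\<D>. \<Union>n. e D n)" by auto
    also have "\<dots> = (\<Union>D\<in>\<D>. D)"
    proof (intro SUP_cong refl)
      fix D assume "D \<in> \<D>"
      then show "(\<Union>n. e D n) = D" using e by simp
    qed
    finally show "\<Union>(\<Union>D\<in>\<D>. range (e D)) = \<Union>\<D>" by simp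
    fix E assume "E \<in> (\<Union>D\<in>\<D>. range (e D))"
    then obtain D n where "D \<in> \<D>" "E = e D n" by auto
    then show "closedin X E \<and> discrete_subspace X E" using e[of D] by simp
  qed
qed

lemma Lindelof_decomposable_regular:
  fixes \<V> :: "'a set set"
  assumes X: "perfectly_normal_space X" "Hausdorff_space X" "collectionwise_Hausdorff_space X"
    and sd: "\<And>Y. locally_countable_subspace X Y \<Longrightarrow> has_card_aleph1 Y \<Longrightarrow> sigma_discrete_subspace X Y"
    and \<V>: "\<And>V. V \<in> \<V> \<Longrightarrow> hereditarily_Lindelof_openin X V" "uncountable \<V>"
    and reg: "regularCard |\<V>|"
    and IH: "\<And>\<W> :: 'a set set. \<lbrakk>|\<W>| <o |\<V>|; \<And>V. V \<in> \<W> \<Longrightarrow> hereditarily_Lindelof_openin X V\<rbrakk>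
               \<Longrightarrow> Lindelof_decomposable X (\<Union>\<W>)"
  shows "Lindelof_decomposable X (\<Union>\<V>)"
proof -
  define r where "r = |\<V>|"
  have F: "Field r = \<V>" by (simp add: r_def Field_card_of)
  have CO: "Card_order r" unfolding r_def by (rule card_of_Card_order)
  have WO: "Well_order r" using CO by (simp add: card_order_on_well_order_on)
  then have wo: "wo_rel r" by (simp add: wo_rel_def)
  have inf: "infinite (Field r)" using \<V>(2) F countable_finite by blast
  have tot: "(a, b) \<in> r \<or> (b, a) \<in> r" if "a \<in> \<V>" "b \<in> \<V>" for a b
    using wo_rel.TOTALS[OF wo] F that by blast
  have trans: "(a, c) \<in> r" if "(a, b) \<in> r" "(b, c) \<in> r" for a b c
    using wo_rel.TRANS[OF wo] that by (meson transD)
  have anti: "a = b" if "(a, b) \<in> r" "(b, a) \<in> r" for a b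
    using wo_rel.ANTISYM[OF wo] that by (meson antisymD)
  have fld: "a \<in> \<V>" "b \<in> \<V>" if "(a, b) \<in> r" for a b
    using that F FieldI1 FieldI2 by fastforce+
  have least: "\<exists>b\<in>A. \<forall>a\<in>A. (b, a) \<in> r" if "A \<subseteq> \<V>" "A \<noteq> {}" for A
    using that wo_rel.minim_in[OF wo, of A] wo_rel.minim_least[OF wo, of A] F by blast
  have bounded: "\<exists>g\<in>\<V>. \<forall>a\<in>K. (a, g) \<in> r" if "K \<subseteq> \<V>" "|K| <o r" for K
    using regularCard_bounded[OF CO, of K] reg that F unfolding r_def by metis
  have Vtop: "\<Union>\<V> \<subseteq> topspace X"
    using \<V>(1) hereditarily_Lindelof_openin_imp_openin openin_subset by blast
  define G where "G = \<Union>\<V>"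
  \<comment> \<open>\<open>S\<close> holds the positions at which the union of the earlier members
    fails to be closed in \<open>G\<close>. Below, \<open>y b\<close> is a limit point witnessing
    this and \<open>h b\<close> a member of \<open>\<V>\<close> containing it.\<close>
  define S where "S = {b \<in> \<V>. \<not> G \<inter> X closure_of \<Union>(underS r b) \<subseteq> \<Union>(underS r b)}"
  have "\<forall>b\<in>S. \<exists>p. fst p \<in> X closure_of \<Union>(underS r b) \<and> fst p \<notin> \<Union>(underS r b) \<and> snd p \<in> \<V> \<and> fst p \<in> snd p"
  proof
    fix b assume "b \<in> S"
    then obtain z where "z \<in> G" "z \<in> X closure_of \<Union>(underS r b)" "z \<notin> \<Union>(underS r b)"
      unfolding S_def by blast
    moreover then obtain V where "V \<in> \<V>" "z \<in> V" unfolding G_def by blast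
    ultimately show "\<exists>p. fst p \<in> X closure_of \<Union>(underS r b) \<and> fst p \<notin> \<Union>(underS r b) \<and> snd p \<in> \<V> \<and> fst p \<in> snd p"
      by (intro exI[of _ "(z, V)"]) simp
  qed
  then obtain p where "\<forall>b\<in>S. fst (p b) \<in> X closure_of \<Union>(underS r b) \<and> fst (p b) \<notin> \<Union>(underS r b)
      \<and> snd (p b) \<in> \<V> \<and> fst (p b) \<in> snd (p b)"
    by (rule bchoice[THEN exE])
  note p = this[THEN bspec]
  define y where "y b = fst (p b)" for b
  define h where "h b = snd (p b)" for b
  have y: "y b \<in> X closure_of \<Union>(underS r b)" "y b \<notin> \<Union>(underS r b)" "h b \<in> \<V>" "y b \<in> h b"
    if "b \<in> S" for b using p[OF that] by (simp_all add: y_def h_def)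
  \<comment> \<open>At positions closed under \<open>h\<close>, every earlier \<open>h a\<close>
    precedes \<open>b\<close>. As \<open>y b\<close> lies in no member before \<open>b\<close>, it
    avoids \<open>h a\<close>: the points are right separated.\<close>
  define T where "T = {b \<in> S. \<forall>a\<in>S. a \<in> underS r b \<longrightarrow> h a \<in> underS r b}"
  have TS: "T \<subseteq> S" and SV: "S \<subseteq> \<V>" by (auto simp: T_def S_def)
  have sep: "y b \<notin> h a" if "a \<in> T" "b \<in> T" "(a, b) \<in> r" "a \<noteq> b" for a b
  proof -
    have "a \<in> underS r b" using that by (simp add: underS_def)
    then have "h a \<in> underS r b" using that TS by (auto simp: T_def)
    then show ?thesis using y(2)[of b] that TS by blast
  qed
  have inj: "inj_on y T"
  proof (rule inj_onI)
    fix a b assume ab: "a \<in> T" "b \<in> T" "y a = y b"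
    have "a \<in> S" "b \<in> S" using ab TS by auto
    then have "y a \<in> h a" "y b \<in> h b" "(a, b) \<in> r \<or> (b, a) \<in> r" using y(4) tot SV by blast+
    then show "a = b" using sep[OF ab(1,2)] sep[OF ab(2,1)] ab(3) by metis
  qed
  obtain \<D> where \<D>: "|\<D>| <o |\<V>|" "\<Union>\<D> = y ` T" "\<And>D. D \<in> \<D> \<Longrightarrow> discrete_subspace X D"
  proof (rule right_separated_few_discrete[OF sd WO, of T h y \<V>])
    show "T \<subseteq> Field r" using TS SV F by blast
    show "hereditarily_Lindelof_openin X (h a) \<and> y a \<in> h a" if "a \<in> T" for a
      using y(3,4) \<V>(1) TS that by blast
    show "|T| \<le>o |\<V>|" using TS SV by (intro card_of_mono1) blast
  qed (use sep \<V>(2) in auto)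
  obtain \<E> where \<E>: "|\<E>| <o |\<V>|" "\<Union>\<E> = \<Union>\<D>"
      "\<And>E. E \<in> \<E> \<Longrightarrow> closedin X E \<and> discrete_subspace X E"
    using few_closed_discrete[OF X(1,2) \<V>(2) \<D>(1,3)] by metis
  have "\<forall>E\<in>\<E>. \<exists>U. (\<forall>d\<in>E. openin X (U d) \<and> d \<in> U d) \<and> disjoint_family_on U E"
  proof
    fix E assume "E \<in> \<E>"
    from X(3)[unfolded collectionwise_Hausdorff_space_def, rule_format, OF \<E>(3)[OF this]]
    show "\<exists>U. (\<forall>d\<in>E. openin X (U d) \<and> d \<in> U d) \<and> disjoint_family_on U E" .
  qed
  then obtain U where "\<forall>E\<in>\<E>. (\<forall>d\<in>E. openin X (U E d) \<and> d \<in> U E d) \<and> disjoint_family_on (U E) E"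
    by (rule bchoice[THEN exE])
  note U = this[THEN bspec]
  \<comment> \<open>\<open>B b\<close> collects the positions whose point has a separating
    neighbourhood meeting \<open>b\<close>. Each closed discrete set contributes countably many by
    the chain condition, and there are fewer than |\<V>| such sets.\<close>
  define B where "B b = (\<Union>E\<in>\<E>. {a \<in> T. y a \<in> E \<and> U E (y a) \<inter> b \<noteq> {}})" for b
  have "|B b| <o |\<V>|" if b: "b \<in> \<V>" for b
    unfolding B_def
  proof (rule UNION_countable_ordLess[OF \<V>(2) \<E>(1)])
    fix E assume E: "E \<in> \<E>"
    have "countable {d \<in> E. U E d \<inter> b \<noteq> {}}"
      using U[OF E] by (intro countable_disjoint_family_meeting[OF \<V>(1)[OF b]]) auto
    moreover have "y ` {a \<in> T. y a \<in> E \<and> U E (y a) \<inter> b \<noteq> {}} \<subseteq> {d \<in> E. U E d \<inter> b \<noteq> {}}" by auto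
    ultimately have "countable (y ` {a \<in> T. y a \<in> E \<and> U E (y a) \<inter> b \<noteq> {}})"
      by (rule countable_subset[rotated])
    moreover have "inj_on y {a \<in> T. y a \<in> E \<and> U E (y a) \<inter> b \<noteq> {}}"
      using inj by (rule inj_on_subset) auto
    ultimately show "countable {a \<in> T. y a \<in> E \<and> U E (y a) \<inter> b \<noteq> {}}"
      by (rule countable_image_inj_on)
  qed
  moreover have "B b \<subseteq> \<V>" for b using TS SV by (auto simp: B_def)
  \<comment> \<open>Regularity bounds each \<open>B b\<close> by a single position
    \<open>g b\<close>.\<close>
  ultimately have "\<forall>b\<in>\<V>. \<exists>g. g \<in> \<V> \<and> (\<forall>a\<in>B b. (a, g) \<in> r)"
    using bounded by (simp add: r_def Bex_def)
  then obtain g where "\<forall>b\<in>\<V>. g b \<in> \<V> \<and> (\<forall>a\<in>B b. (a, g b) \<in> r)"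
    by (rule bchoice[THEN exE])
  note g = this[THEN bspec]
  \<comment> \<open>The \<open>clo\<close> sets are the initial segments closed under
    \<open>g\<close> and, at positions of \<open>S\<close>, under \<open>h\<close>; both closures
    are needed to show that their unions are closed in \<open>G\<close>.\<close>
  define clo where "clo A \<longleftrightarrow> A \<subseteq> \<V> \<and>
      (\<forall>a\<in>A. underS r a \<subseteq> A \<and> g a \<in> A \<and> (a \<in> S \<longrightarrow> h a \<in> A))" for A
  have down: "b \<in> A" if "clo A" "a \<in> A" "(b, a) \<in> r" for a b A
    using that by (cases "b = a") (auto simp: clo_def underS_def)
  have closed: "G \<inter> X closure_of \<Union>A \<subseteq> \<Union>A" if A: "clo A" for A
  proof (cases "A = \<V>")
    case False
    then have "\<V> - A \<noteq> {}" using A by (auto simp: clo_def)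
    then obtain c where c: "c \<in> \<V> - A" "\<And>a. a \<in> \<V> - A \<Longrightarrow> (c, a) \<in> r"
      using least[of "\<V> - A"] by auto
    have Ac: "A = underS r c"
    proof
      show "A \<subseteq> underS r c"
      proof
        fix a assume a: "a \<in> A"
        then have "(c, a) \<notin> r" using down[OF A a] c(1) by blast
        moreover have "a \<in> \<V>" using A a by (auto simp: clo_def)
        ultimately show "a \<in> underS r c" using tot[of a c] c(1) a by (auto simp: underS_def)
      qed
      show "underS r c \<subseteq> A"
      proof
        fix a assume "a \<in> underS r c"
        then have a: "(a, c) \<in> r" "a \<noteq> c" by (auto simp: underS_def)
        then show "a \<in> A" using c(2)[of a] anti[OF a(1)] fld(1)[OF a(1)] by blast
      qed
    qed
    \<comment> \<open>Otherwise closure under \<open>h\<close> puts \<open>c\<close> in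
      \<open>T\<close>. The neighbourhood separating \<open>y c\<close> meets some \<open>b\<close>
      in \<open>A\<close>, so \<open>c\<close> is at most \<open>g b\<close>, which lies in
      \<open>A\<close>; but \<open>c\<close> is the least position outside \<open>A\<close>.\<close>
    have "c \<notin> S"
    proof
      assume cS: "c \<in> S"
      then have cT: "c \<in> T" using A Ac by (auto simp: T_def clo_def)
      then have "y c \<in> \<Union>\<E>" using \<E>(2) \<D>(2) by simp
      then obtain E where E: "E \<in> \<E>" "y c \<in> E" by blast
      then have "openin X (U E (y c))" "y c \<in> U E (y c)" using U[OF E(1)] by auto
      moreover have "y c \<in> X closure_of \<Union>A" using y(1)[OF cS] Ac by simp
      ultimately have "\<exists>z. z \<in> \<Union>A \<and> z \<in> U E (y c)"
        by (simp only: in_closure_of)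
      then obtain z where z: "z \<in> \<Union>A" "z \<in> U E (y c)" by blast
      then obtain b where b: "b \<in> A" "z \<in> b" by blast
      then have "U E (y c) \<inter> b \<noteq> {}" using z(2) by blast
      then have "c \<in> B b" unfolding B_def using cT E by (intro UN_I[of E]) auto
      moreover have "b \<in> \<V>" using A b(1) by (auto simp: clo_def)
      ultimately have "(c, g b) \<in> r" using g[of b] by simp
      moreover have "g b \<in> A" using A b(1) by (auto simp: clo_def)
      ultimately show False using down[OF A, of "g b" c] c(1) by simp
    qed
    then have "G \<inter> X closure_of \<Union>(underS r c) \<subseteq> \<Union>(underS r c)" using c(1) by (simp add: S_def)
    then show ?thesis unfolding Ac .
  qed (simp add: G_def)
  have small: "\<exists>A. clo A \<and> a \<in> A \<and> |A| <o r" if a: "a \<in> \<V>" for a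
  proof -
    \<comment> \<open>By regularity, one position bounds all values of \<open>g\<close> and the
      relevant values of \<open>h\<close> on a segment.\<close>
    have "\<exists>t. t \<in> \<V> \<and> (\<forall>x\<in>under r s. (g x, t) \<in> r \<and> (x \<in> S \<longrightarrow> (h x, t) \<in> r))" if s: "s \<in> \<V>" for s
    proof -
      have us: "|under r s| <o r" using CO inf s F by (intro card_of_under_ordLess) auto
      have uV: "x \<in> \<V>" if "x \<in> under r s" for x using that fld by (auto simp: under_def)
      define K where "K = g ` under r s \<union> h ` (under r s \<inter> S)"
      have "|K| <o r"
        unfolding K_def
      proof (rule card_of_Un_ordLess_infinite_Field[OF inf CO])
        show "|g ` under r s| <o r" using card_of_image us by (rule ordLeq_ordLess_trans)
        have "|under r s \<inter> S| <o r"
          by (rule ordLeq_ordLess_trans[OF card_of_mono1[OF Int_lower1] us])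
        then show "|h ` (under r s \<inter> S)| <o r" by (rule ordLeq_ordLess_trans[OF card_of_image])
      qed
      moreover have "K \<subseteq> \<V>"
      proof
        fix x assume "x \<in> K"
        then consider z where "x = g z" "z \<in> \<V>" | z where "x = h z" "z \<in> S"
          using uV unfolding K_def by (auto simp: image_iff)
        then show "x \<in> \<V>" using g y(3) by cases simp_all
      qed
      ultimately have "\<exists>t\<in>\<V>. \<forall>a\<in>K. (a, t) \<in> r" by (intro bounded)
      then show ?thesis by (auto simp: K_def)
    qed
    then have "\<forall>s\<in>\<V>. \<exists>t. t \<in> \<V> \<and> (\<forall>x\<in>under r s. (g x, t) \<in> r \<and> (x \<in> S \<longrightarrow> (h x, t) \<in> r))"
      by (rule ballI)
    then obtain nx where "\<forall>s\<in>\<V>. nx s \<in> \<V> \<and> (\<forall>x\<in>under r s. (g x, nx s) \<in> r \<and> (x \<in> S \<longrightarrow> (h x, nx s) \<in> r))"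
      by (rule bchoice[THEN exE])
    note nx = this[THEN bspec]
    \<comment> \<open>Iterating this bound \<omega> times from \<open>a\<close> gives a
      \<open>clo\<close> set. A regular uncountable cardinal bounds the sequence by some
      \<open>u\<close>, so the set is small.\<close>
    define q where "q n = (nx ^^ n) a" for n
    have q: "q n \<in> \<V>" for n by (induction n) (use a nx in \<open>auto simp: q_def\<close>)
    have qS: "q (Suc n) = nx (q n)" for n by (simp add: q_def)
    have "|range q| <o r"
    proof -
      have "|range q| \<le>o |UNIV :: nat set|" by (rule card_of_image)
      then show ?thesis using uncountable_nat_ordLess[OF \<V>(2)] unfolding r_def by (rule ordLeq_ordLess_trans)
    qed
    then obtain u where u: "u \<in> \<V>" "\<And>n. (q n, u) \<in> r" using bounded[of "range q"] q by auto
    let ?A = "\<Union>n. under r (q n)"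
    have "clo ?A"
      unfolding clo_def
    proof (intro conjI ballI)
      show "?A \<subseteq> \<V>" using fld by (auto simp: under_def)
      fix x assume "x \<in> ?A"
      then obtain n where n: "x \<in> under r (q n)" by blast
      show "underS r x \<subseteq> ?A"
      proof
        fix z assume "z \<in> underS r x"
        then have "z \<in> under r (q n)" using n trans[of z x "q n"] by (simp add: under_def underS_def)
        then show "z \<in> ?A" by blast
      qed
      show "g x \<in> ?A" using nx[OF q[of n]] n qS[of n] by (auto simp: under_def intro!: exI[of _ "Suc n"])
      show "x \<in> S \<longrightarrow> h x \<in> ?A" using nx[OF q[of n]] n qS[of n] by (auto simp: under_def intro!: exI[of _ "Suc n"])
    qed
    moreover have "a \<in> ?A"
    proof -
      have "a \<in> under r (q 0)" using tot[OF a a] by (simp add: q_def under_def)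
      then show ?thesis by blast
    qed
    moreover have "|?A| <o r"
    proof -
      have "?A \<subseteq> under r u" using trans[OF _ u(2)] by (auto simp: under_def)
      moreover have "|under r u| <o r" using CO inf u F by (intro card_of_under_ordLess) auto
      ultimately show ?thesis by (rule ordLeq_ordLess_trans[OF card_of_mono1])
    qed
    ultimately show ?thesis by blast
  qed
  \<comment> \<open>\<open>cl a\<close> is the least \<open>clo\<close> set containing
    \<open>a\<close>; later it labels the block of \<open>a\<close>.\<close>
  define cl where "cl a = \<Inter>{A. clo A \<and> a \<in> A}" for a
  have cl_in: "a \<in> cl a" for a by (auto simp: cl_def)
  have cl_min: "cl a \<subseteq> A" if "clo A" "a \<in> A" for a A using that by (auto simp: cl_def)
  have cl_clo: "clo (cl a)" if a: "a \<in> \<V>" for a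
  proof -
    obtain A where "clo A" "a \<in> A" using small[OF a] by blast
    then have "cl a \<subseteq> \<V>" using cl_min[of A a] by (auto simp: clo_def)
    moreover have "underS r x \<subseteq> A \<and> g x \<in> A \<and> (x \<in> S \<longrightarrow> h x \<in> A)" if "clo A" "x \<in> A" for A x
      using that by (simp add: clo_def)
    ultimately show ?thesis unfolding clo_def[of "cl a"] by (auto simp: cl_def)
  qed
  have cl_small: "|cl a| <o r" if a: "a \<in> \<V>" for a
  proof -
    obtain A where A: "clo A" "a \<in> A" "|A| <o r" using small[OF a] by blast
    show ?thesis by (rule ordLeq_ordLess_trans[OF card_of_mono1[OF cl_min[OF A(1,2)]] A(3)])
  qed
  \<comment> \<open>Unions of \<open>clo\<close> sets are \<open>clo\<close>, so
    \<open>pre b\<close> is the largest one missing \<open>b\<close>.\<close>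
  define pre where "pre b = \<Union>{A. clo A \<and> b \<notin> A}" for b
  have pre_sup: "A \<subseteq> pre b" if "clo A" "b \<notin> A" for A b
    unfolding pre_def using that by (intro Union_upper) simp
  have pre_clo: "clo (pre b)" for b
    unfolding clo_def
  proof (intro conjI ballI)
    show "pre b \<subseteq> \<V>" by (auto simp: pre_def clo_def)
    fix x assume "x \<in> pre b"
    then obtain A where A: "clo A" "b \<notin> A" "x \<in> A" by (auto simp: pre_def)
    have "underS r x \<subseteq> A" "g x \<in> A" "x \<in> S \<longrightarrow> h x \<in> A" using A(1,3) by (simp_all add: clo_def)
    then show "underS r x \<subseteq> pre b" "g x \<in> pre b" "x \<in> S \<longrightarrow> h x \<in> pre b"
      using pre_sup[OF A(1,2)] by auto
  qed
  have pre_not: "b \<notin> pre b" for b by (auto simp: pre_def)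
  \<comment> \<open>Removing what was covered before the block of \<open>b\<close> leaves an open
    set, because the union of \<open>pre b\<close> is closed in \<open>G\<close>.\<close>
  define W where "W b = b - \<Union>(pre b)" for b
  have hLW: "hereditarily_Lindelof_openin X (W b)" if b: "b \<in> \<V>" for b
  proof (rule hereditarily_Lindelof_openin_subset[OF \<V>(1)[OF b]])
    have "\<Union>(pre b) \<subseteq> X closure_of \<Union>(pre b)"
      using pre_clo[of b] Vtop by (intro closure_of_subset) (auto simp: clo_def)
    then have "W b = b - X closure_of \<Union>(pre b)"
      using closed[OF pre_clo[of b]] b by (auto simp: W_def G_def)
    moreover have "openin X b" using \<V>(1)[OF b] by (rule hereditarily_Lindelof_openin_imp_openin)
    ultimately show "openin X (W b)" by (simp add: openin_diff)
  qed (simp add: W_def)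
  have "\<Union>(W ` \<V>) = \<Union>\<V>"
  proof
    show "\<Union>(W ` \<V>) \<subseteq> \<Union>\<V>" by (auto simp: W_def)
    show "\<Union>\<V> \<subseteq> \<Union>(W ` \<V>)"
    proof
      fix x assume "x \<in> \<Union>\<V>"
      then have "{b \<in> \<V>. x \<in> b} \<noteq> {}" by blast
      \<comment> \<open>Take the first member containing \<open>x\<close>. A member of
        \<open>pre b\<close> containing \<open>x\<close> would be at or after \<open>b\<close> and
        force \<open>b\<close> into the initial segment \<open>pre b\<close>.\<close>
      then obtain b where b: "b \<in> \<V>" "x \<in> b" "\<And>a. a \<in> \<V> \<Longrightarrow> x \<in> a \<Longrightarrow> (b, a) \<in> r"
        using least[of "{b \<in> \<V>. x \<in> b}"] by auto
      have "x \<notin> \<Union>(pre b)"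
      proof
        assume "x \<in> \<Union>(pre b)"
        then obtain a where a: "a \<in> pre b" "x \<in> a" by blast
        then have "(b, a) \<in> r" using b(3) pre_clo[of b] by (auto simp: clo_def)
        then show False using down[OF pre_clo a(1)] pre_not by blast
      qed
      then show "x \<in> \<Union>(W ` \<V>)" using b by (auto simp: W_def)
    qed
  qed
  moreover have "Lindelof_decomposable X (\<Union>(W ` \<V>))"
  proof (rule Lindelof_decomposable_glue)
    \<comment> \<open>If some \<open>clo\<close> set contained \<open>a\<close> but not
      \<open>b\<close>, it would lie in \<open>pre b\<close>, and \<open>W b\<close> would miss all
      of \<open>a\<close>. So \<open>b\<close> belongs to \<open>cl a\<close>, and the labels
      agree.\<close>
    have eq: "cl a = cl b" if ab: "(a, b) \<in> r" "W a \<inter> W b \<noteq> {}" for a b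
    proof
      obtain x where x: "x \<in> a" "x \<notin> \<Union>(pre b)" using ab(2) by (auto simp: W_def)
      then have "b \<in> A" if "clo A" "a \<in> A" for A using pre_sup[OF that(1), of b] that(2) by blast
      then have "b \<in> cl a" by (simp add: cl_def)
      then show "cl b \<subseteq> cl a" using cl_clo fld ab(1) by (intro cl_min) auto
      have "a \<in> cl b" using down[OF cl_clo cl_in ab(1)] fld[OF ab(1)] by blast
      then show "cl a \<subseteq> cl b" using cl_clo fld[OF ab(1)] by (intro cl_min) auto
    qed
    show "cl a = cl b" if "a \<in> \<V>" "b \<in> \<V>" "W a \<inter> W b \<noteq> {}" for a b
      using tot[OF that(1,2)] eq[of a b] eq[of b a] that(3) by (auto simp: Int_commute)
    fix a assume a: "a \<in> \<V>"
    show "Lindelof_decomposable X (\<Union>(W ` {b \<in> \<V>. cl b = cl a}))"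
    proof (rule IH)
      have "{b \<in> \<V>. cl b = cl a} \<subseteq> cl a" using cl_in by blast
      then have "|{b \<in> \<V>. cl b = cl a}| <o |\<V>|"
        using cl_small[OF a] unfolding r_def by (rule ordLeq_ordLess_trans[OF card_of_mono1])
      then show "|W ` {b \<in> \<V>. cl b = cl a}| <o |\<V>|"
        using card_of_image by (rule ordLeq_ordLess_trans[rotated])
      show "hereditarily_Lindelof_openin X V" if "V \<in> W ` {b \<in> \<V>. cl b = cl a}" for V
        using that hLW by auto
    qed
  qed
  ultimately show ?thesis by simp
qed

section \<open>Induction on the cardinality of the family\<close>

lemma Lindelof_decomposable_Union:
  fixes \<V> :: "'a set set"
  assumes X: "perfectly_normal_space X" "Hausdorff_space X" "collectionwise_Hausdorff_space X"
    and sd: "\<And>Y. locally_countable_subspace X Y \<Longrightarrow> has_card_aleph1 Y \<Longrightarrow> sigma_discrete_subspace X Y"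
    and \<V>: "\<And>V. V \<in> \<V> \<Longrightarrow> hereditarily_Lindelof_openin X V"
  shows "Lindelof_decomposable X (\<Union>\<V>)"
proof -
  have wf: "wf (inv_image ordLess (\<lambda>\<V> :: 'a set set. |\<V>| ))"
    by (rule wf_inv_image[OF wf_ordLess])
  from wf \<V> show ?thesis
  proof (induction \<V> rule: wf_induct_rule)
    case (less \<V>)
    have IH: "Lindelof_decomposable X (\<Union>\<W>)"
      if "|\<W>| <o |\<V>|" "\<And>V. V \<in> \<W> \<Longrightarrow> hereditarily_Lindelof_openin X V" for \<W> :: "'a set set"
      using less.IH[of \<W>] that by (simp add: inv_image_def)
    consider "countable \<V>" | "uncountable \<V>" "regularCard |\<V>|" | "uncountable \<V>" "\<not> regularCard |\<V>|"
      by blast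
    then show ?case
    proof cases
      case 1
      then have "hereditarily_Lindelof_openin X (\<Union>\<V>)"
        using less.prems by (rule hereditarily_Lindelof_openin_Union)
      then show ?thesis
        unfolding Lindelof_decomposable_def by (intro exI[of _ "{\<Union>\<V>}"]) simp
    next
      case 2
      then show ?thesis
        using Lindelof_decomposable_regular[OF X sd less.prems] IH by blast
    next
      case 3
      \<comment> \<open>Failure of regularity yields a cofinal set not equinumerous with
        \<open>\<V>\<close>; being a subset, it is strictly smaller.\<close>
      then obtain K where K: "K \<subseteq> \<V>" "cofinal K |\<V>|" "\<not> |K| =o |\<V>|"
        unfolding regularCard_def Field_card_of by blast
      have "|K| <o |\<V>|"
        using K(3) card_of_mono1[OF K(1)] ordLeq_iff_ordLess_or_ordIso by blast
      then show ?thesis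
        using Lindelof_decomposable_singular[OF less.prems 3(1) K(1,2)] IH by blast
    qed
  qed
qed

section \<open>Paracompactness from the three hypotheses\<close>

theorem theorem2p4:
  assumes countably_compact_compact:
    "\<And>X :: 'a topology.
       Hausdorff_space X \<Longrightarrow> countably_compact_space X \<Longrightarrow> perfectly_normal_space X \<Longrightarrow>
       compact_space X"
  and locally_countable_sigma_discrete:
    "\<And>(X :: 'a topology) Y.
       compact_space X \<Longrightarrow> Hausdorff_space X \<Longrightarrow> sequential_space X \<Longrightarrow>
       locally_countable_subspace X Y \<Longrightarrow> has_card_aleph1 Y \<Longrightarrow>
       sigma_discrete_subspace X Y"
  and normal_first_countable_cwH:
    "\<And>X :: 'a topology.
       Hausdorff_space X \<Longrightarrow> normal_space X \<Longrightarrow> first_countable X \<Longrightarrow>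
       collectionwise_Hausdorff_space X"
  shows "\<forall>X :: 'a topology.
       Hausdorff_space X \<and> locally_compact_space X \<and> perfectly_normal_space X \<longrightarrow>
       paracompact_space X"
proof (intro allI impI, elim conjE)
  fix X :: "'a topology"
  assume H: "Hausdorff_space X" and lc: "locally_compact_space X" and pn: "perfectly_normal_space X"
  have fc: "first_countable X"
    using H lc pn by (rule locally_compact_perfectly_normal_first_countable)
  have cwH: "collectionwise_Hausdorff_space X"
    using H pn fc by (intro normal_first_countable_cwH) (auto simp: perfectly_normal_space_def)
  \<comment> \<open>Closed subspaces inherit perfect normality, so hypothesis (1) makes the
    countably compact ones compact.\<close>
  have seq: "sequential_space (Alexandroff_compactification X)"
  proof (rule sequential_space_Alexandroff_compactification[OF fc])
    fix A assume A: "closedin X A" "countably_compact_space (subtopology X A)"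
    then have "compact_space (subtopology X A)"
      using H pn by (intro countably_compact_compact Hausdorff_space_subtopology
          perfectly_normal_space_closed_subtopology)
    then show "compactin X A" using closedin_subset[OF A(1)] by (simp add: compactin_subspace)
  qed
  have sd: "sigma_discrete_subspace X Y"
    if "locally_countable_subspace X Y" "has_card_aleph1 Y" for Y
    using locally_countable_sigma_discrete H lc seq that by (rule locally_countable_imp_sigma_discrete)
  define \<V> where "\<V> = {V. hereditarily_Lindelof_openin X V}"
  have "\<Union>\<V> = topspace X"
  proof
    show "\<Union>\<V> \<subseteq> topspace X"
      using hereditarily_Lindelof_openin_imp_openin openin_subset by (fastforce simp: \<V>_def)
    show "topspace X \<subseteq> \<Union>\<V>"
    proof
      fix x assume "x \<in> topspace X"
      then obtain V where "hereditarily_Lindelof_openin X V" "x \<in> V"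
        using hereditarily_Lindelof_openin_locally[OF pn lc] by metis
      then show "x \<in> \<Union>\<V>" by (auto simp: \<V>_def)
    qed
  qed
  moreover have "Lindelof_decomposable X (\<Union>\<V>)"
    using pn H cwH sd by (rule Lindelof_decomposable_Union) (auto simp: \<V>_def)
  ultimately have "\<exists>\<P>. disjoint \<P> \<and> \<Union>\<P> = topspace X \<and> (\<forall>P\<in>\<P>. hereditarily_Lindelof_openin X P)"
    by (simp add: Lindelof_decomposable_def)
  then obtain \<P> where P: "disjoint \<P>" "\<Union>\<P> = topspace X" "\<forall>P\<in>\<P>. hereditarily_Lindelof_openin X P"
    by blast
  show "paracompact_space X"
    using locally_compact_Hausdorff_imp_regular_space[OF lc H] P(1,2) bspec[OF P(3)]
    by (rule paracompact_space_disjoint_union)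
qed

end
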